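(* Let $p$ be a prime, let $K$ be an algebraically closed field of characteristic $p$, let $h$ be a positive integer and put $q=p^h$. Let $R=K[x_0,\dots,x_q,y_0,\dots,y_q]$ be the polynomial ring in $2q+2$ indeterminates and let $I_{q,q}$ be the ideal of $R$ generated by the 2-minors of $$A_{q,q}=\begin{pmatrix} x_0&x_1&\dots&x_{q-1}&y_0&y_1&\dots&y_{q-1}\\ x_1&x_2&\dots&x_q&y_1&y_2&\dots&y_q\end{pmatrix}.$$ For $1\le i\le q-1$ put $$F_i=\sum_{k=0}^i(-1)^k\binom{i}{k}x_{i+1}^{i-k}x_kx_i^k,\qquad G_i=\sum_{k=0}^i(-1)^k\binom{i}{k}y_{i+1}^{i-k}y_ky_i^k.$$ Then $$I_{q,q}=\operatorname{Rad}(F_1,\dots,F_{q-1},G_1,\dots,G_{q-1},x_0y_q-x_qy_0).$$ In particular, $I_{q,q}$ is a set-theoretic complete intersection.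
   Context: $\operatorname{Rad}$ denotes the radical of an ideal. Elements $P_1,\dots,P_s\in R$ are said to generate an ideal $I$ up to radical if $\operatorname{Rad}(P_1,\dots,P_s)=\operatorname{Rad}(I)$. An ideal $I$ is called a set-theoretic complete intersection if it can be generated up to radical by $s=\operatorname{height}(I)$ elements. In this setting $I_{q,q}$ is a prime ideal of height $2q-1$. *)

theory Defs
  imports
    "HOL-Library.Poly_Mapping"
    "HOL-Library.Extended_Nat"
    "HOL-Computational_Algebra.Primes"
    "HOL-Computational_Algebra.Polynomial"
    "HOL-Algebra.Ideal"
    "Jordan_Normal_Form.Determinant"
    "Jordan_Normal_Form.DL_Submatrix"
begin

definition radical :: "('a, 'b) ring_scheme \<Rightarrow> 'a set \<Rightarrow> 'a set" where
  "radical R I = {a \<in> carrier R. \<exists>n::nat. n > 0 \<and> a [^]\<^bsub>R\<^esub> n \<in> I}"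

definition generates_up_to_radical ::
    "('a, 'b) ring_scheme \<Rightarrow> 'a list \<Rightarrow> 'a set \<Rightarrow> bool" where
  "generates_up_to_radical R Ps I \<longleftrightarrow>
     set Ps \<subseteq> carrier R \<and> radical R (genideal R (set Ps)) = radical R I"

definition prime_height :: "('a, 'b) ring_scheme \<Rightarrow> 'a set \<Rightarrow> enat" where
  "prime_height R P =
     Sup {enat n | n. \<exists>C :: nat \<Rightarrow> 'a set.
       (\<forall>i\<le>n. primeideal (C i) R) \<and> (\<forall>i<n. C i \<subset> C (Suc i)) \<and> C n = P}"

text \<open>The height of the unit ideal is \<open>\<infinity>\<close> (infimum of the empty set).\<close>

definition height :: "('a, 'b) ring_scheme \<Rightarrow> 'a set \<Rightarrow> enat" where
  "height R I = (INF P\<in>{P. primeideal P R \<and> I \<subseteq> P}. prime_height R P)"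

definition set_theoretic_complete_intersection ::
    "('a, 'b) ring_scheme \<Rightarrow> 'a set \<Rightarrow> bool" where
  "set_theoretic_complete_intersection R I \<longleftrightarrow>
     ideal I R \<and>
     (\<exists>Ps. enat (length Ps) = height R I \<and> generates_up_to_radical R Ps I)"

definition minors :: "nat \<Rightarrow> 'a::comm_ring_1 mat \<Rightarrow> 'a set" where
  "minors k A = {det (submatrix A I J) | I J.
     I \<subseteq> {..<dim_row A} \<and> J \<subseteq> {..<dim_col A} \<and> card I = k \<and> card J = k}"

text \<open>
  A polynomial is a finitely supported map from monomials to coefficients, a monomial being a
  finitely supported map from indeterminates to exponents. \<open>mpoly_ring V\<close> is the polynomial ring
  in the indeterminates belonging to \<open>V\<close>.
\<close>

type_synonym 'k mpoly = "(nat \<Rightarrow>\<^sub>0 nat) \<Rightarrow>\<^sub>0 'k"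

definition indets :: "'k::zero mpoly \<Rightarrow> nat set" where
  "indets P = (\<Union>m\<in>Poly_Mapping.keys P. Poly_Mapping.keys m)"

definition Var :: "nat \<Rightarrow> 'k::comm_ring_1 mpoly" where
  "Var v = Poly_Mapping.single (Poly_Mapping.single v 1) 1"

definition mpoly_ring :: "nat set \<Rightarrow> 'k::comm_ring_1 mpoly ring" where
  "mpoly_ring V =
     \<lparr>carrier = {P. indets P \<subseteq> V}, monoid.mult = (*), one = 1, zero = 0, add = (+)\<rparr>"

text \<open>
  The \<open>2q + 2\<close> indeterminates \<open>x\<^sub>0, \<dots>, x\<^sub>q, y\<^sub>0, \<dots>, y\<^sub>q\<close> are numbered consecutively:
  \<open>x\<^sub>i\<close> has number \<open>i\<close> and \<open>y\<^sub>i\<close> has number \<open>q + 1 + i\<close>.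
\<close>

definition scroll_ring :: "nat \<Rightarrow> 'k::comm_ring_1 mpoly ring" where
  "scroll_ring q = mpoly_ring {..<2 * q + 2}"

definition xvar :: "nat \<Rightarrow> 'k::comm_ring_1 mpoly" where
  "xvar i = Var i"

definition yvar :: "nat \<Rightarrow> nat \<Rightarrow> 'k::comm_ring_1 mpoly" where
  "yvar q i = Var (q + 1 + i)"

definition scroll_matrix :: "nat \<Rightarrow> 'k::comm_ring_1 mpoly mat" where
  "scroll_matrix q =
     mat 2 (2 * q) (\<lambda>(r, c). if c < q then xvar (c + r) else yvar q (c - q + r))"

definition scroll_ideal :: "nat \<Rightarrow> 'k::comm_ring_1 mpoly set" where
  "scroll_ideal q = genideal (scroll_ring q) (minors 2 (scroll_matrix q))"

definition scroll_form :: "(nat \<Rightarrow> 'k::comm_ring_1 mpoly) \<Rightarrow> nat \<Rightarrow> 'k mpoly" where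
  "scroll_form z i =
     (\<Sum>k=0..i. (- 1) ^ k * of_nat (i choose k) * z (i + 1) ^ (i - k) * z k * z i ^ k)"

definition F_poly :: "nat \<Rightarrow> 'k::comm_ring_1 mpoly" where
  "F_poly i = scroll_form xvar i"

definition G_poly :: "nat \<Rightarrow> nat \<Rightarrow> 'k::comm_ring_1 mpoly" where
  "G_poly q i = scroll_form (yvar q) i"

end

theory Submission
  imports Defs "HOL-Algebra.Ring_Divisibility"
begin

text \<open>
  The scroll ideal is the kernel of \<open>x\<^sub>i \<mapsto> a s\<^sup>i, y\<^sub>i \<mapsto> b s\<^sup>i\<close>, hence prime: modulo the minors a
  monomial depends only on its degrees in \<open>x\<close> and \<open>y\<close> and on the sum of its indices.

  Let \<open>Q\<close> be a prime ideal containing the \<open>2q - 1\<close> forms. If \<open>x\<^sub>0 \<notin> Q\<close>, then in the residue field the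
  \<open>F\<^sub>i\<close> give successively \<open>x\<^sub>i / x\<^sub>0 = (x\<^sub>1 / x\<^sub>0)\<^sup>i\<close>; if \<open>x\<^sub>0 \<in> Q\<close>, they give \<open>x\<^sub>i \<in> Q\<close> for \<open>i < q\<close>.
  The same holds for the \<open>y\<^sub>i\<close>. When \<open>x\<^sub>0, y\<^sub>0 \<notin> Q\<close>, the last form says that \<open>x\<^sub>1 / x\<^sub>0\<close> and \<open>y\<^sub>1 / y\<^sub>0\<close> have
  the same \<open>q\<close>-th power, so they agree in characteristic \<open>p\<close>. In every case all minors lie in \<open>Q\<close>.

  For the height, a chain of kernels of partial parametrizations has length \<open>2q - 1\<close>. No chain ending
  at the scroll ideal is longer: it can be prolonged by three primes, and elements chosen from the
  successive differences of a chain of primes are algebraically independent, so that a chain in a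
  polynomial ring is at most as long as the number of indeterminates.
\<close>

hide_const (open) Divisibility.prime

section \<open>Substitution\<close>

lemma mpoly_expansion: "f = (\<Sum>m\<in>Poly_Mapping.keys f. Poly_Mapping.single m (Poly_Mapping.lookup f m))"
proof (rule poly_mapping_eqI)
  fix k
  have "(\<Sum>m\<in>Poly_Mapping.keys f. Poly_Mapping.lookup (Poly_Mapping.single m (Poly_Mapping.lookup f m)) k) =
     (\<Sum>m\<in>Poly_Mapping.keys f. if m = k then Poly_Mapping.lookup f m else 0)"
    by (intro sum.cong) (auto simp: lookup_single when_def)
  also have "\<dots> = Poly_Mapping.lookup f k"
    by (simp add: sum.delta' in_keys_iff)
  finally show "Poly_Mapping.lookup f k = Poly_Mapping.lookup (\<Sum>m\<in>Poly_Mapping.keys f. Poly_Mapping.single m (Poly_Mapping.lookup f m)) k"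
    by (simp add: lookup_sum)
qed

definition monom_eval :: "(nat \<Rightarrow> 'a::comm_semiring_1) \<Rightarrow> (nat \<Rightarrow>\<^sub>0 nat) \<Rightarrow> 'a" where
  "monom_eval t m = (\<Prod>v\<in>Poly_Mapping.keys m. t v ^ Poly_Mapping.lookup m v)"

text \<open>The values on monomials are arbitrary. Multiplicative values give a substitution; the
  kernel computation below also needs a merely linear choice of representatives.\<close>

definition linear_extension ::
    "((nat \<Rightarrow>\<^sub>0 nat) \<Rightarrow> 'k mpoly) \<Rightarrow> 'k::comm_ring_1 mpoly \<Rightarrow> 'k mpoly" where
  "linear_extension r f =
     (\<Sum>m\<in>Poly_Mapping.keys f. Poly_Mapping.single 0 (Poly_Mapping.lookup f m) * r m)"

definition poly_subst :: "(nat \<Rightarrow> 'k::comm_ring_1 mpoly) \<Rightarrow> 'k mpoly \<Rightarrow> 'k mpoly" where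
  "poly_subst t = linear_extension (monom_eval t)"

lemma monom_eval_superset:
  assumes "finite A" "Poly_Mapping.keys m \<subseteq> A"
  shows "monom_eval t m = (\<Prod>v\<in>A. t v ^ Poly_Mapping.lookup m v)"
  unfolding monom_eval_def
  by (rule prod.mono_neutral_left) (use assms in \<open>auto simp: in_keys_iff\<close>)

lemma monom_eval_zero [simp]: "monom_eval t 0 = 1"
  by (simp add: monom_eval_def)

lemma monom_eval_add: "monom_eval t (m + n) = monom_eval t m * monom_eval t n"
proof -
  define A where "A = Poly_Mapping.keys m \<union> Poly_Mapping.keys n"
  have A: "finite A" "Poly_Mapping.keys m \<subseteq> A" "Poly_Mapping.keys n \<subseteq> A" "Poly_Mapping.keys (m + n) \<subseteq> A"
    using keys_add[of m n] by (auto simp: A_def)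
  show ?thesis
    using A by (simp add: monom_eval_superset[of A] lookup_add power_add prod.distrib)
qed

lemma monom_eval_single [simp]: "monom_eval t (Poly_Mapping.single v n) = t v ^ n"
  by (cases "n = 0") (simp_all add: monom_eval_def)

lemma monom_eval_cong:
  "(\<And>v. v \<in> Poly_Mapping.keys m \<Longrightarrow> s v = t v) \<Longrightarrow> monom_eval s m = monom_eval t m"
  by (simp add: monom_eval_def)

lemma Var_power: "(Var v :: 'k::comm_ring_1 mpoly) ^ n = Poly_Mapping.single (Poly_Mapping.single v n) 1"
proof (induction n)
  case (Suc n)
  then show ?case by (simp add: Var_def mult_single flip: single_add)
qed simp

lemma prod_single:
  "finite A \<Longrightarrow> (\<Prod>v\<in>A. Poly_Mapping.single (e v) (1::'k::comm_ring_1)) =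
     Poly_Mapping.single (\<Sum>v\<in>A. e v) 1"
  by (induction rule: finite_induct) (simp_all add: mult_single)

lemma monom_eval_Var: "monom_eval Var m = (Poly_Mapping.single m 1 :: 'k::comm_ring_1 mpoly)"
proof -
  have "monom_eval Var m = (Poly_Mapping.single (\<Sum>v\<in>Poly_Mapping.keys m. Poly_Mapping.single v (Poly_Mapping.lookup m v)) 1 :: 'k mpoly)"
    unfolding monom_eval_def Var_power by (simp add: prod_single)
  then show ?thesis using mpoly_expansion[of m] by simp
qed

lemma linear_extension_superset:
  assumes "finite A" "Poly_Mapping.keys f \<subseteq> A"
  shows "linear_extension r f = (\<Sum>m\<in>A. Poly_Mapping.single 0 (Poly_Mapping.lookup f m) * r m)"
  unfolding linear_extension_def
  by (rule sum.mono_neutral_left) (use assms in \<open>auto simp: in_keys_iff\<close>)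

lemma linear_extension_add:
  "linear_extension r (f + g) = linear_extension r f + linear_extension r g"
proof -
  define A where "A = Poly_Mapping.keys f \<union> Poly_Mapping.keys g"
  have A: "finite A" "Poly_Mapping.keys f \<subseteq> A" "Poly_Mapping.keys g \<subseteq> A" "Poly_Mapping.keys (f + g) \<subseteq> A"
    using keys_add[of f g] by (auto simp: A_def)
  show ?thesis
    using A by (simp add: linear_extension_superset[of A] lookup_add single_add distrib_right sum.distrib)
qed

lemma linear_extension_zero [simp]: "linear_extension r 0 = 0"
  by (simp add: linear_extension_def)

lemma linear_extension_sum:
  "linear_extension r (sum f A) = (\<Sum>a\<in>A. linear_extension r (f a))"
  by (induction A rule: infinite_finite_induct) (simp_all add: linear_extension_add)

lemma linear_extension_single:
  "linear_extension r (Poly_Mapping.single m c) = Poly_Mapping.single 0 c * r m"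
  by (cases "c = 0") (simp_all add: linear_extension_def)

lemma poly_subst_add: "poly_subst t (f + g) = poly_subst t f + poly_subst t g"
  by (simp add: poly_subst_def linear_extension_add)

lemma poly_subst_zero [simp]: "poly_subst t 0 = 0"
  by (simp add: poly_subst_def)

lemma poly_subst_uminus: "poly_subst t (- f) = - poly_subst t f"
  using poly_subst_add[of t f "- f"] by (simp add: add_eq_0_iff)

lemma poly_subst_diff: "poly_subst t (f - g) = poly_subst t f - poly_subst t g"
  using poly_subst_add[of t f "- g"] by (simp add: poly_subst_uminus)

lemma poly_subst_sum: "poly_subst t (sum f A) = (\<Sum>a\<in>A. poly_subst t (f a))"
  by (simp add: poly_subst_def linear_extension_sum)

lemma poly_subst_single: "poly_subst t (Poly_Mapping.single m c) = Poly_Mapping.single 0 c * monom_eval t m"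
  by (simp add: poly_subst_def linear_extension_single)

lemma poly_subst_one [simp]: "poly_subst t 1 = 1"
  using poly_subst_single[of t 0 1] by simp

lemma poly_subst_Var [simp]: "poly_subst t (Var v) = t v"
  by (simp add: Var_def poly_subst_single)

lemma mpoly_times_expansion:
  fixes f g :: "'k::comm_ring_1 mpoly"
  shows "f * g = (\<Sum>m\<in>Poly_Mapping.keys f. \<Sum>n\<in>Poly_Mapping.keys g.
    Poly_Mapping.single m (Poly_Mapping.lookup f m) * Poly_Mapping.single n (Poly_Mapping.lookup g n))"
  by (subst mpoly_expansion[of f], subst mpoly_expansion[of g]) (simp add: sum_product)

lemma poly_subst_mult: "poly_subst t (f * g) = poly_subst t f * poly_subst t g"
proof -
  \<comment> \<open>By bilinearity it is enough to multiply two terms, whose exponents add.\<close>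
  have *: "poly_subst t (Poly_Mapping.single m c * Poly_Mapping.single n d) =
      (Poly_Mapping.single 0 c * monom_eval t m) * (Poly_Mapping.single 0 d * monom_eval t n)" for m n c d
  proof -
    have c: "Poly_Mapping.single (0::nat \<Rightarrow>\<^sub>0 nat) (c * d) = Poly_Mapping.single 0 c * Poly_Mapping.single 0 d"
      by (simp add: mult_single)
    show ?thesis
      unfolding mult_single[of m] poly_subst_single monom_eval_add c by (simp add: mult_ac)
  qed
  show ?thesis
    unfolding mpoly_times_expansion[of f g]
    by (simp add: poly_subst_sum *) (simp add: poly_subst_def linear_extension_def sum_product)
qed

lemma poly_subst_power: "poly_subst t (f ^ n) = poly_subst t f ^ n"
  by (induction n) (simp_all add: poly_subst_mult)

lemma poly_subst_prod: "poly_subst t (prod f A) = (\<Prod>a\<in>A. poly_subst t (f a))"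
  by (induction A rule: infinite_finite_induct) (simp_all add: poly_subst_mult)

lemma poly_subst_const [simp]: "poly_subst t (Poly_Mapping.single 0 c) = Poly_Mapping.single 0 c"
  by (simp add: poly_subst_single)

lemma poly_subst_poly_subst:
  "poly_subst s (poly_subst t f) = poly_subst (\<lambda>v. poly_subst s (t v)) f"
  unfolding poly_subst_def[of t] poly_subst_def[of "\<lambda>v. poly_subst s (t v)"] linear_extension_def
  by (simp add: poly_subst_sum poly_subst_mult monom_eval_def poly_subst_prod poly_subst_power)

lemma poly_subst_cong:
  "(\<And>v. v \<in> indets f \<Longrightarrow> s v = t v) \<Longrightarrow> poly_subst s f = poly_subst t f"
  unfolding poly_subst_def linear_extension_def
  by (intro sum.cong refl arg_cong2[of _ _ _ _ "(*)"] monom_eval_cong) (auto simp: indets_def)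

section \<open>Indeterminates occurring in sums, products and substitutions\<close>

lemma indets_add: "indets (f + g) \<subseteq> indets f \<union> indets g"
  using keys_add[of f g] unfolding indets_def by blast

lemma indets_uminus [simp]: "indets (- f) = indets (f :: 'k::comm_ring_1 mpoly)"
  by (simp add: indets_def in_keys_iff)

lemma indets_single: "indets (Poly_Mapping.single m c) \<subseteq> Poly_Mapping.keys m"
  by (auto simp: indets_def split: if_splits)

lemma indets_zero [simp]: "indets 0 = {}"
  by (simp add: indets_def)

lemma indets_const [simp]: "indets (Poly_Mapping.single 0 c) = {}"
  by (simp add: indets_def)

lemma indets_one [simp]: "indets (1 :: 'k::comm_ring_1 mpoly) = {}"
  by (simp add: indets_def)

lemma indets_Var [simp]: "indets (Var v :: 'k::comm_ring_1 mpoly) = {v}"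
  by (simp add: Var_def indets_def)

lemma indets_mult: "indets (f * g) \<subseteq> indets f \<union> indets (g :: 'k::comm_ring_1 mpoly)"
proof
  fix v assume "v \<in> indets (f * g)"
  then obtain m where m: "m \<in> Poly_Mapping.keys (f * g)" "v \<in> Poly_Mapping.keys m"
    by (auto simp: indets_def)
  with keys_mult[of f g] obtain a b where "m = a + b" "a \<in> Poly_Mapping.keys f" "b \<in> Poly_Mapping.keys g"
    by blast
  with m keys_add[of a b] show "v \<in> indets f \<union> indets g"
    by (auto simp: indets_def)
qed

abbreviation polys_in :: "nat set \<Rightarrow> 'k::comm_ring_1 mpoly set" where
  "polys_in V \<equiv> {f. indets f \<subseteq> V}"

lemma indets_add_subset [simp, intro]: "indets f \<subseteq> V \<Longrightarrow> indets g \<subseteq> V \<Longrightarrow> indets (f + g) \<subseteq> V"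
  using indets_add[of f g] by blast

lemma indets_diff_subset [simp, intro]:
  "indets f \<subseteq> V \<Longrightarrow> indets g \<subseteq> V \<Longrightarrow> indets (f - g :: 'k::comm_ring_1 mpoly) \<subseteq> V"
  using indets_add[of f "- g"] by auto

lemma indets_mult_subset [simp, intro]:
  "indets f \<subseteq> V \<Longrightarrow> indets g \<subseteq> V \<Longrightarrow> indets (f * g :: 'k::comm_ring_1 mpoly) \<subseteq> V"
  using indets_mult[of f g] by blast

lemma indets_sum_subset [intro]: "(\<And>a. a \<in> A \<Longrightarrow> indets (f a) \<subseteq> V) \<Longrightarrow> indets (sum f A) \<subseteq> V"
  by (induction A rule: infinite_finite_induct) simp_all

lemma indets_power_subset [simp, intro]:
  "indets f \<subseteq> V \<Longrightarrow> indets (f ^ n :: 'k::comm_ring_1 mpoly) \<subseteq> V"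
  by (induction n) simp_all

lemma indets_prod_subset [intro]:
  "(\<And>a. a \<in> A \<Longrightarrow> indets (f a :: 'k::comm_ring_1 mpoly) \<subseteq> V) \<Longrightarrow> indets (prod f A) \<subseteq> V"
  by (induction A rule: infinite_finite_induct) simp_all

lemma indets_monom_eval_subset:
  "(\<And>v. v \<in> Poly_Mapping.keys m \<Longrightarrow> indets (t v :: 'k::comm_ring_1 mpoly) \<subseteq> V) \<Longrightarrow> indets (monom_eval t m) \<subseteq> V"
  unfolding monom_eval_def by (intro indets_prod_subset indets_power_subset)

lemma indets_poly_subst_subset:
  "(\<And>v. v \<in> indets f \<Longrightarrow> indets (t v :: 'k::comm_ring_1 mpoly) \<subseteq> V) \<Longrightarrow> indets (poly_subst t f) \<subseteq> V"
  unfolding poly_subst_def linear_extension_def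
  by (intro indets_sum_subset indets_mult_subset indets_monom_eval_subset) (auto simp: indets_def)

section \<open>Ideals and prime ideals of the polynomial ring\<close>

lemma mpoly_ring_simps [simp]:
  "carrier (mpoly_ring V) = polys_in V" "monoid.mult (mpoly_ring V) = (*)" "one (mpoly_ring V) = 1"
  "zero (mpoly_ring V) = 0" "add (mpoly_ring V) = (+)"
  by (simp_all add: mpoly_ring_def)

lemma cring_mpoly_ring: "cring (mpoly_ring V :: 'k::comm_ring_1 mpoly ring)"
proof (rule cringI)
  show "abelian_group (mpoly_ring V :: 'k mpoly ring)"
  proof (rule abelian_groupI)
    fix f :: "'k mpoly" assume "f \<in> carrier (mpoly_ring V)"
    then show "\<exists>g\<in>carrier (mpoly_ring V). g \<oplus>\<^bsub>mpoly_ring V\<^esub> f = \<zero>\<^bsub>mpoly_ring V\<^esub>"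
      by (intro bexI[of _ "- f"]) auto
  qed (simp_all add: add_ac)
  show "comm_monoid (mpoly_ring V :: 'k mpoly ring)"
    by (rule comm_monoidI) (simp_all add: mult_ac)
qed (simp add: distrib_right)

lemma a_inv_mpoly_ring:
  assumes "f \<in> polys_in V"
  shows "\<ominus>\<^bsub>mpoly_ring V\<^esub> f = - (f :: 'k::comm_ring_1 mpoly)"
proof -
  interpret cring "mpoly_ring V :: 'k mpoly ring" by (rule cring_mpoly_ring)
  show ?thesis using minus_equality[of "- f" f] assms by simp
qed

lemma ideal_mpoly_ringI:
  assumes "I \<subseteq> polys_in V" "0 \<in> I" "\<And>f g. f \<in> I \<Longrightarrow> g \<in> I \<Longrightarrow> f + g \<in> I"
    and "\<And>f r. f \<in> I \<Longrightarrow> indets r \<subseteq> V \<Longrightarrow> r * f \<in> I"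
  shows "ideal I (mpoly_ring V :: 'k::comm_ring_1 mpoly ring)"
proof -
  interpret cring "mpoly_ring V :: 'k mpoly ring" by (rule cring_mpoly_ring)
  show ?thesis
  proof (rule idealI)
    show "subgroup I (add_monoid (mpoly_ring V))"
    proof (rule add.subgroupI)
      fix f assume f: "f \<in> I"
      \<comment> \<open>Closure under negation is a case of closure under multiplication by
        constants.\<close>
      then have "(- 1) * f \<in> I" by (intro assms(4)) auto
      then show "\<ominus>\<^bsub>mpoly_ring V\<^esub> f \<in> I"
        using f assms(1) by (subst a_inv_mpoly_ring) auto
    qed (use assms(1-3) in auto)
    show "Ring.ring (mpoly_ring V)" by (rule cring.axioms(1)[OF cring_mpoly_ring])
  qed (use assms(4) in \<open>auto simp: mult.commute\<close>)
qed

lemma ideal_mpoly_ringD: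
  assumes "ideal I (mpoly_ring V :: 'k::comm_ring_1 mpoly ring)"
  shows "I \<subseteq> polys_in V" "0 \<in> I" "\<And>f g. f \<in> I \<Longrightarrow> g \<in> I \<Longrightarrow> f + g \<in> I"
    "\<And>f r. f \<in> I \<Longrightarrow> indets r \<subseteq> V \<Longrightarrow> r * f \<in> I"
    "\<And>f g. f \<in> I \<Longrightarrow> g \<in> I \<Longrightarrow> f - g \<in> I"
proof -
  interpret ideal I "mpoly_ring V" by (rule assms)
  show 1: "I \<subseteq> polys_in V" and 2: "0 \<in> I" and 3: "\<And>f g. f \<in> I \<Longrightarrow> g \<in> I \<Longrightarrow> f + g \<in> I"
    and 4: "\<And>f r. f \<in> I \<Longrightarrow> indets r \<subseteq> V \<Longrightarrow> r * f \<in> I"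
    using a_subset additive_subgroup.zero_closed[OF is_additive_subgroup]
      additive_subgroup.a_closed[OF is_additive_subgroup] I_l_closed by auto
  show "f - g \<in> I" if "f \<in> I" "g \<in> I" for f g
    using 3[OF that(1) 4[OF that(2), of "- 1"]] by simp
qed

lemma primeideal_mpoly_ringI:
  assumes "ideal P (mpoly_ring V :: 'k::comm_ring_1 mpoly ring)" "1 \<notin> P"
    and "\<And>f g. indets f \<subseteq> V \<Longrightarrow> indets g \<subseteq> V \<Longrightarrow> f * g \<in> P \<Longrightarrow> f \<in> P \<or> g \<in> P"
  shows "primeideal P (mpoly_ring V)"
  by (rule primeidealI) (use assms cring_mpoly_ring in auto)

lemma primeideal_mpoly_ringD:
  assumes "primeideal P (mpoly_ring V :: 'k::comm_ring_1 mpoly ring)"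
  shows "ideal P (mpoly_ring V)" "1 \<notin> P"
    and "\<And>f g. indets f \<subseteq> V \<Longrightarrow> indets g \<subseteq> V \<Longrightarrow> f * g \<in> P \<Longrightarrow> f \<in> P \<or> g \<in> P"
proof -
  interpret primeideal P "mpoly_ring V" by (rule assms)
  show "ideal P (mpoly_ring V)" by (rule ideal_axioms)
  show "1 \<notin> P" using I_notcarr one_imp_carrier by auto
  show "\<And>f g. indets f \<subseteq> V \<Longrightarrow> indets g \<subseteq> V \<Longrightarrow> f * g \<in> P \<Longrightarrow> f \<in> P \<or> g \<in> P"
    using I_prime by auto
qed

definition subst_kernel :: "nat set \<Rightarrow> (nat \<Rightarrow> 'k::comm_ring_1 mpoly) \<Rightarrow> 'k mpoly set" where
  "subst_kernel V t = {f \<in> polys_in V. poly_subst t f = 0}"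

text \<open>The quotient embeds into a polynomial ring over a domain. All primes in the explicit
  chains below arise in this way.\<close>

lemma primeideal_subst_kernel:
  "primeideal (subst_kernel V t) (mpoly_ring V :: 'k::idom mpoly ring)"
proof (rule primeideal_mpoly_ringI)
  show "ideal (subst_kernel V t) (mpoly_ring V)"
    by (rule ideal_mpoly_ringI)
       (auto simp: subst_kernel_def poly_subst_add poly_subst_mult)
qed (auto simp: subst_kernel_def poly_subst_mult)

section \<open>Prime ideals containing the forms\<close>

text \<open>Krull's argument: by Zorn's lemma there is an ideal maximal among those that contain
  \<open>J\<close> and avoid all powers of \<open>f\<close>, and such an ideal is prime.\<close>

lemma (in cring) prime_ideal_avoiding_element:
  assumes J: "ideal J R" and f: "f \<in> carrier R" and notin: "\<And>n::nat. f [^] n \<notin> J"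
  obtains Q where "primeideal Q R" "J \<subseteq> Q" "f \<notin> Q"
proof -
  define S where "S = {I. ideal I R \<and> J \<subseteq> I \<and> (\<forall>n::nat. f [^] n \<notin> I)}"
  have "\<exists>U\<in>S. \<forall>X\<in>C. X \<subseteq> U" if C: "subset.chain S C" for C
  proof (cases "C = {}")
    \<comment> \<open>The union of the empty chain is not an ideal, so \<open>J\<close> itself
      serves as the upper bound.\<close>
    case True
    then show ?thesis using J notin by (auto simp: S_def)
  next
    case False
    have "subset.chain {I. ideal I R} C"
      using C by (auto simp: pred_on.chain_def S_def)
    with False have "ideal (\<Union>C) R"
      using chain_Union_is_ideal[of C] by simp
    moreover have "\<forall>X\<in>C. J \<subseteq> X \<and> (\<forall>n::nat. f [^] n \<notin> X)"
      using C by (auto simp: pred_on.chain_def S_def)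
    ultimately have "\<Union>C \<in> S"
      using False by (auto simp: S_def)
    then show ?thesis by blast
  qed
  then obtain Q where Q: "Q \<in> S" and max: "\<forall>X\<in>S. Q \<subseteq> X \<longrightarrow> X = Q"
    using subset_Zorn[of S] by blast
  interpret Q: ideal Q R using Q by (simp add: S_def)
  \<comment> \<open>By maximality, enlarging \<open>Q\<close> by any outside element
    \<open>a\<close> must catch a power of \<open>f\<close>.\<close>
  have meets: "\<exists>n::nat. \<exists>r\<in>carrier R. \<exists>u\<in>Q. f [^] n = r \<otimes> a \<oplus> u"
    if a: "a \<in> carrier R" "a \<notin> Q" for a
  proof (rule ccontr)
    assume no: "\<not> ?thesis"
    define X where "X = PIdl a <+>\<^bsub>R\<^esub> Q"
    have X: "ideal X R"
      unfolding X_def by (intro add_ideals cgenideal_ideal a Q.is_ideal)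
    have in_X: "r \<otimes> a \<oplus> u \<in> X" if "r \<in> carrier R" "u \<in> Q" for r u
      using that by (auto simp: X_def set_add_def' cgenideal_def)
    have "Q \<subseteq> X"
    proof
      fix u assume "u \<in> Q"
      with in_X[of \<zero> u] a show "u \<in> X" by simp
    qed
    moreover have "a \<in> X"
      using in_X[of \<one> \<zero>] a by simp
    moreover have "f [^] n \<notin> X" for n :: nat
      using no by (auto simp: X_def set_add_def' cgenideal_def)
    ultimately have "X \<in> S"
      using X Q by (auto simp: S_def)
    with max \<open>Q \<subseteq> X\<close> \<open>a \<in> X\<close> a show False by blast
  qed
  have "primeideal Q R"
  proof (rule primeidealI)
    \<comment> \<open>The exponent 0 is among those avoided, which makes \<open>Q\<close>
      proper.\<close>
    have "f [^] (0::nat) \<notin> Q" using Q by (simp only: S_def) blast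
    then show "carrier R \<noteq> Q" by auto
    fix a b assume ab: "a \<in> carrier R" "b \<in> carrier R" "a \<otimes> b \<in> Q"
    show "a \<in> Q \<or> b \<in> Q"
    proof (rule ccontr)
      assume "\<not> ?thesis"
      then obtain m n :: nat and r s u v
        where 1: "r \<in> carrier R" "u \<in> Q" "f [^] m = r \<otimes> a \<oplus> u"
          and 2: "s \<in> carrier R" "v \<in> Q" "f [^] n = s \<otimes> b \<oplus> v"
        using meets[OF ab(1)] meets[OF ab(2)] by blast
      have c: "u \<in> carrier R" "v \<in> carrier R" using 1 2 by auto
      have "f [^] (m + n) = (r \<otimes> a \<oplus> u) \<otimes> (s \<otimes> b \<oplus> v)"
        using f 1 2 by (simp flip: nat_pow_mult)
      \<comment> \<open>Each summand has a factor in \<open>Q\<close>: the product of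
        \<open>a\<close> and \<open>b\<close>, or \<open>v\<close>, or \<open>u\<close>.\<close>
      also have "\<dots> = (r \<otimes> s) \<otimes> (a \<otimes> b) \<oplus> (r \<otimes> a) \<otimes> v \<oplus> (s \<otimes> b \<oplus> v) \<otimes> u"
        using 1(1) 2(1) c ab by algebra
      also have "\<dots> \<in> Q"
      proof -
        have "(r \<otimes> s) \<otimes> (a \<otimes> b) \<in> Q" "(r \<otimes> a) \<otimes> v \<in> Q" "(s \<otimes> b \<oplus> v) \<otimes> u \<in> Q"
          using 1(1,2) 2(1,2) ab c by (simp_all add: Q.I_l_closed)
        then show ?thesis by (simp add: additive_subgroup.a_closed[OF Q.is_additive_subgroup])
      qed
      finally show False using Q by (auto simp: S_def)
    qed
  qed (use Q.is_ideal is_cring in auto)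
  moreover have "f [^] (1::nat) \<notin> Q" "J \<subseteq> Q"
    using Q by (auto simp only: S_def)
  ultimately show thesis using that f by auto
qed

lemma (in cring) in_radical_if_in_primes:
  assumes J: "ideal J R" and f: "f \<in> carrier R"
    and primes: "\<And>Q. primeideal Q R \<Longrightarrow> J \<subseteq> Q \<Longrightarrow> f \<in> Q"
  shows "f \<in> radical R J"
proof (rule ccontr)
  assume no: "f \<notin> radical R J"
  have "f [^] n \<notin> J" for n :: nat
  proof
    assume n: "f [^] n \<in> J"
    \<comment> \<open>The radical asks for a positive exponent, whereas \<open>n\<close> may be
      0.\<close>
    have "f [^] Suc n \<in> J"
      using ideal.I_r_closed[OF J n f] f by simp
    with no f show False by (auto simp: radical_def)
  qed
  with prime_ideal_avoiding_element[OF J f] primes show False by blast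
qed

lemma (in primeideal) radical_eq: "radical R I = I"
proof -
  have "a \<in> I" if "a \<in> carrier R" "a [^] n \<in> I" for a and n :: nat
    using that
  proof (induction n)
    case 0
    then show ?case using I_notcarr one_imp_carrier by auto
  next
    case (Suc n)
    then show ?case using I_prime[of "a [^] n" a] by auto
  qed
  moreover have "a \<in> radical R I" if "a \<in> I" for a
    using that a_subset by (auto simp: radical_def intro!: exI[of _ "1::nat"])
  ultimately show ?thesis
    by (intro equalityI subsetI) (unfold radical_def, blast+)
qed

lemma radical_mono: "I \<subseteq> J \<Longrightarrow> radical R I \<subseteq> radical R J"
  by (auto simp: radical_def)

section \<open>Characteristic and Frobenius\<close>

lemma CHAR_mpoly: "CHAR('k::comm_ring_1 mpoly) = CHAR('k)"
proof (rule CHAR_eqI)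
  \<comment> \<open>Multiples of 1 are constants, so the coefficient at the monomial 0
    decides.\<close>
  have *: "(of_nat n :: 'k mpoly) = 0 \<longleftrightarrow> (of_nat n :: 'k) = 0" for n
  proof
    assume "(of_nat n :: 'k mpoly) = 0"
    then have "Poly_Mapping.lookup (of_nat n :: 'k mpoly) 0 = 0" by simp
    then show "(of_nat n :: 'k) = 0" by (simp add: lookup_of_nat)
  next
    assume "(of_nat n :: 'k) = 0"
    then show "(of_nat n :: 'k mpoly) = 0" by (metis single_of_nat single_zero)
  qed
  show "(of_nat CHAR('k) :: 'k mpoly) = 0"
    by (simp add: *)
  show "CHAR('k) dvd n" if "(of_nat n :: 'k mpoly) = 0" for n
    using that by (simp add: * of_nat_eq_0_iff_char_dvd)
qed

lemma freshmans_dream_diff: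
  fixes a b :: "'a::comm_ring_1"
  assumes "prime CHAR('a)" "m = CHAR('a) ^ n"
  shows "(a - b) ^ m = a ^ m - b ^ m"
  \<comment> \<open>Applying the rule for sums to \<open>(a - b) + b\<close> avoids a discussion of
    the sign of \<open>(- 1) ^ m\<close>.\<close>
  using freshmans_dream'[OF assms, of "a - b" b] by simp

section \<open>Calculation modulo a prime ideal\<close>

locale prime_mpoly_ideal =
  fixes V :: "nat set" and Q :: "'k::comm_ring_1 mpoly set"
  assumes prime: "primeideal Q (mpoly_ring V)"
begin

lemmas is_ideal = primeideal_mpoly_ringD(1)[OF prime]
lemmas Q_zero [simp] = ideal_mpoly_ringD(2)[OF is_ideal]
lemmas Q_add = ideal_mpoly_ringD(3)[OF is_ideal]
lemmas Q_mult = ideal_mpoly_ringD(4)[OF is_ideal]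
lemmas Q_diff = ideal_mpoly_ringD(5)[OF is_ideal]
lemmas Q_prime = primeideal_mpoly_ringD(3)[OF prime]

lemma Q_mult': "f \<in> Q \<Longrightarrow> indets r \<subseteq> V \<Longrightarrow> f * r \<in> Q"
  using Q_mult[of f r] by (simp add: mult.commute)

lemma Q_sum: "(\<And>a. a \<in> A \<Longrightarrow> f a \<in> Q) \<Longrightarrow> sum f A \<in> Q"
  by (induction A rule: infinite_finite_induct) (simp_all add: Q_add)

lemma Q_power: "indets f \<subseteq> V \<Longrightarrow> f ^ n \<in> Q \<Longrightarrow> f \<in> Q"
proof (induction n)
  case 0
  then show ?case using primeideal_mpoly_ringD(2)[OF prime] by simp
next
  case (Suc n)
  then show ?case using Q_prime[of f "f ^ n"] by auto
qed

text \<open>This replaces division by a nonzero element of the residue field; no fractions are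
  formed, and denominators are cleared by powers instead.\<close>

lemma Q_cancel: "indets f \<subseteq> V \<Longrightarrow> indets g \<subseteq> V \<Longrightarrow> f \<notin> Q \<Longrightarrow> f ^ n * g \<in> Q \<Longrightarrow> g \<in> Q"
  using Q_prime[of "f ^ n" g] Q_power[of f n] by auto

text \<open>Equality in the residue ring, expressed by representatives.\<close>

definition eqv :: "'k mpoly \<Rightarrow> 'k mpoly \<Rightarrow> bool" where
  "eqv f g \<longleftrightarrow> f - g \<in> Q"

lemma eqv_refl [simp]: "eqv f f"
  by (simp add: eqv_def)

lemma eqv_sym: "eqv f g \<Longrightarrow> eqv g f"
  unfolding eqv_def using Q_diff[OF Q_zero, of "f - g"] by simp

lemma eqv_trans [trans]: "eqv f g \<Longrightarrow> eqv g h \<Longrightarrow> eqv f h"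
  unfolding eqv_def using Q_add[of "f - g" "g - h"] by simp

lemma eqv_diff: "eqv f g \<Longrightarrow> eqv f' g' \<Longrightarrow> eqv (f - f') (g - g')"
  unfolding eqv_def using Q_diff[of "f - g" "f' - g'"] by (simp add: algebra_simps)

text \<open>The difference of the products is \<open>(f - g) * f' + g * (f' - g')\<close>, so
  \<open>f'\<close> and \<open>g\<close> are the two cofactors that must lie in the polynomial
  ring.\<close>

lemma eqv_mult:
  assumes "eqv f g" "eqv f' g'" "indets g \<subseteq> V" "indets f' \<subseteq> V"
  shows "eqv (f * f') (g * g')"
proof -
  have "(f - g) * f' + g * (f' - g') \<in> Q"
    using assms unfolding eqv_def by (intro Q_add Q_mult Q_mult')
  then show ?thesis by (simp add: eqv_def algebra_simps)
qed

lemma eqv_power: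
  assumes "eqv f g" "indets f \<subseteq> V" "indets g \<subseteq> V"
  shows "eqv (f ^ n) (g ^ n)"
  by (induction n) (use assms in \<open>simp_all add: eqv_mult\<close>)

lemma eqv_sum: "(\<And>a. a \<in> A \<Longrightarrow> eqv (f a) (g a)) \<Longrightarrow> eqv (sum f A) (sum g A)"
  unfolding eqv_def using Q_sum[of A "\<lambda>a. f a - g a"] by (simp add: sum_subtractf)

lemma eqv_mem: "eqv f g \<Longrightarrow> g \<in> Q \<Longrightarrow> f \<in> Q"
  unfolding eqv_def using Q_add[of "f - g" g] by simp

text \<open>Modulo \<open>Q\<close> the forms say, after setting \<open>z\<^sub>0 = 1\<close> and given \<open>z\<^sub>k = z\<^sub>1\<^sup>k\<close> for \<open>k \<le> i\<close>,
  that \<open>(z\<^sub>i\<^sub>+\<^sub>1 - z\<^sub>1\<^sup>i\<^sup>+\<^sup>1)\<^sup>i = 0\<close>. The powers of \<open>z\<^sub>0\<close> clear the denominators.\<close>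

lemma scroll_forms_curve:
  assumes z: "\<And>i. i \<le> n \<Longrightarrow> indets (z i) \<subseteq> V" and z0: "z 0 \<notin> Q"
    and forms: "\<And>i. 1 \<le> i \<Longrightarrow> i < n \<Longrightarrow> scroll_form z i \<in> Q"
  shows "Suc k \<le> n \<Longrightarrow> eqv (z 0 ^ k * z (Suc k)) (z 1 ^ Suc k)"
proof (induction k rule: less_induct)
  case (less i)
  show ?case
  proof (cases "i = 0")
    case False
    note [simp] = z
    \<comment> \<open>The induction index belongs to \<open>z (Suc k)\<close>, hence the exponent
      \<open>k - 1\<close> for \<open>z k\<close>.\<close>
    have IH: "eqv (z 1 ^ k) (z 0 ^ (k - 1) * z k)" if "1 \<le> k" "k \<le> i" for k
      using less.IH[of "k - 1"] that less.prems by (auto intro: eqv_sym)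
    \<comment> \<open>One more factor \<open>z 0\<close> makes the relation meaningful at
      \<open>k = 0\<close> too, where both sides are \<open>z 0\<close>.\<close>
    have IH0: "eqv (z 0 * z 1 ^ k) (z 0 ^ k * z k)" if "k \<le> i" for k
    proof (cases k)
      case (Suc l)
      then have "eqv (z 0 * z 1 ^ k) (z 0 * (z 0 ^ (k - 1) * z k))"
        using that less.prems by (intro eqv_mult IH) auto
      with Suc show ?thesis by (simp add: mult_ac)
    qed simp
    \<comment> \<open>\<open>X\<close> and \<open>Y\<close> are the two sides of the claim; the aim
      is to put \<open>(X - Y) ^ i\<close> into \<open>Q\<close>.\<close>
    define X where "X = z 0 ^ i * z (Suc i)"
    define Y where "Y = z 1 ^ Suc i"
    have X [simp]: "indets X \<subseteq> V" and Y [simp]: "indets Y \<subseteq> V"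
      using less.prems by (auto simp: X_def Y_def)
    have "z 0 * (X - Y) ^ i = z 0 * (\<Sum>k\<le>i. of_nat (i choose k) * (- Y) ^ k * X ^ (i - k))"
      using binomial_ring[of "- Y" X i] by simp
    \<comment> \<open>The power \<open>Y ^ k\<close> is split so that one part, joined with the
      extra \<open>z 0\<close>, becomes \<open>z k\<close> by \<open>IH0\<close>, and the other
      becomes a power of \<open>z i\<close> by \<open>IH\<close>.\<close>
    also have "\<dots> = (\<Sum>k\<le>i. ((- 1) ^ k * of_nat (i choose k) * X ^ (i - k)) * ((z 0 * z 1 ^ k) * (z 1 ^ i) ^ k))"
      unfolding sum_distrib_left
    proof (intro sum.cong refl)
      fix k
      have "Y ^ k = z 1 ^ k * (z 1 ^ i) ^ k"
        by (simp add: Y_def power_mult_distrib)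
      then show "z 0 * (of_nat (i choose k) * (- Y) ^ k * X ^ (i - k)) =
          ((- 1) ^ k * of_nat (i choose k) * X ^ (i - k)) * ((z 0 * z 1 ^ k) * (z 1 ^ i) ^ k)"
        by (subst power_minus) (simp add: mult_ac)
    qed
    finally have 1: "z 0 * (X - Y) ^ i = \<dots>" .
    have nat: "indets (of_nat m :: 'k mpoly) \<subseteq> V" for m
      by (induction m) auto
    have sgn: "indets ((- 1) ^ m :: 'k mpoly) \<subseteq> V" for m
      by (rule indets_power_subset) simp
    have "eqv (z 0 * (X - Y) ^ i)
       (\<Sum>k\<le>i. ((- 1) ^ k * of_nat (i choose k) * X ^ (i - k)) * ((z 0 ^ k * z k) * (z 0 ^ (i - 1) * z i) ^ k))"
      unfolding 1 using False less.prems nat sgn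
      by (intro eqv_sum eqv_mult eqv_power IH IH0 eqv_refl) auto
    also have "(\<Sum>k\<le>i. ((- 1) ^ k * of_nat (i choose k) * X ^ (i - k)) * ((z 0 ^ k * z k) * (z 0 ^ (i - 1) * z i) ^ k))
        = z 0 ^ (i * i) * scroll_form z i"
      unfolding scroll_form_def sum_distrib_left atLeast0AtMost
    proof (intro sum.cong refl)
      fix k assume k: "k \<in> {..i}"
      \<comment> \<open>The powers of \<open>z 0\<close> coming from \<open>X\<close>,
        \<open>IH0\<close> and \<open>IH\<close> have a total exponent that does not depend on
        \<open>k\<close>, so they factor out of the sum.\<close>
      have "i * i = i * (i - k) + k + (i - 1) * k"
      proof -
        have "(i - 1) * k + k = i * k" using False by (cases i) auto
        moreover have "i * (i - k) + i * k = i * i" using k by (simp flip: distrib_left)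
        ultimately show ?thesis by simp
      qed
      then have e: "z 0 ^ (i * i) = z 0 ^ (i * (i - k)) * z 0 ^ k * z 0 ^ ((i - 1) * k)"
        by (simp add: power_add)
      show "((- 1) ^ k * of_nat (i choose k) * X ^ (i - k)) * ((z 0 ^ k * z k) * (z 0 ^ (i - 1) * z i) ^ k)
         = z 0 ^ (i * i) * ((- 1) ^ k * of_nat (i choose k) * z (i + 1) ^ (i - k) * z k * z i ^ k)"
        unfolding e by (simp add: X_def power_mult_distrib mult_ac flip: power_mult)
    qed
    finally have "eqv (z 0 * (X - Y) ^ i) (z 0 ^ (i * i) * scroll_form z i)" .
    moreover have "z 0 ^ (i * i) * scroll_form z i \<in> Q"
      using forms[of i] False less.prems by (intro Q_mult) auto
    ultimately have "z 0 * (X - Y) ^ i \<in> Q"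
      by (rule eqv_mem)
    then have "(X - Y) ^ i \<in> Q"
      using Q_cancel[of "z 0" "(X - Y) ^ i" 1] z0 by auto
    then have "X - Y \<in> Q"
      by (rule Q_power[rotated]) auto
    then show ?thesis by (simp add: eqv_def X_def Y_def)
  qed simp
qed

text \<open>Multiplying by \<open>z 0\<close> brings all indices, including 0, into one
  formula.\<close>

lemma scroll_forms_curve':
  assumes z: "\<And>i. i \<le> n \<Longrightarrow> indets (z i) \<subseteq> V" and z0: "z 0 \<notin> Q"
    and forms: "\<And>i. 1 \<le> i \<Longrightarrow> i < n \<Longrightarrow> scroll_form z i \<in> Q" and k: "k \<le> n"
  shows "eqv (z 0 ^ k * z k) (z 0 * z 1 ^ k)"
proof (cases k)
  case (Suc l)
  have "eqv (z 0 * (z 0 ^ l * z (Suc l))) (z 0 * z 1 ^ Suc l)"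
    using Suc k by (intro eqv_mult scroll_forms_curve[of n] assms eqv_refl) (auto simp: z)
  with Suc show ?thesis by (simp add: mult_ac)
qed simp

text \<open>In form \<open>i\<close> all summands but the last contain some \<open>z k\<close> with
  \<open>k < i\<close>, which is in \<open>Q\<close> by induction; what remains is a power of
  \<open>z i\<close> up to sign. The last index \<open>n\<close> is not reached and has to come from
  the form \<open>z 0 * w q - z q * w 0\<close>.\<close>

lemma scroll_forms_degenerate:
  assumes z: "\<And>i. i \<le> n \<Longrightarrow> indets (z i) \<subseteq> V" and z0: "z 0 \<in> Q"
    and forms: "\<And>i. 1 \<le> i \<Longrightarrow> i < n \<Longrightarrow> scroll_form z i \<in> Q"
  shows "k < n \<Longrightarrow> z k \<in> Q"
proof (induction k rule: less_induct)
  case (less i)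
  show ?case
  proof (cases "i = 0")
    case False
    note [simp] = z
    have nat: "indets (of_nat m :: 'k mpoly) \<subseteq> V" for m
      by (induction m) auto
    have sgn: "indets ((- 1) ^ m :: 'k mpoly) \<subseteq> V" for m
      by (rule indets_power_subset) simp
    have "scroll_form z i = (\<Sum>k<i. (- 1) ^ k * of_nat (i choose k) * z (i + 1) ^ (i - k) * z k * z i ^ k)
       + (- 1) ^ i * z i ^ Suc i"
      by (simp add: scroll_form_def atLeast0AtMost mult_ac flip: lessThan_Suc_atMost)
    moreover have "(\<Sum>k<i. (- 1) ^ k * of_nat (i choose k) * z (i + 1) ^ (i - k) * z k * z i ^ k) \<in> Q"
      using less nat sgn by (intro Q_sum Q_mult Q_mult') auto
    moreover have "scroll_form z i \<in> Q"
      using forms[of i] False less.prems by simp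
    ultimately have "(- 1) ^ i * z i ^ Suc i \<in> Q"
      using Q_diff[of "scroll_form z i" "\<Sum>k<i. (- 1) ^ k * of_nat (i choose k) * z (i + 1) ^ (i - k) * z k * z i ^ k"]
      by simp
    then have "(- 1) ^ i * ((- 1) ^ i * z i ^ Suc i) \<in> Q"
      by (rule Q_mult) (rule sgn)
    also have "(- 1) ^ i * ((- 1) ^ i * z i ^ Suc i) = z i ^ Suc i"
      by (simp flip: mult.assoc power_mult_distrib)
    finally show ?thesis
      using less.prems by (intro Q_power[of "z i" "Suc i"]) auto
  qed (simp add: z0)
qed

text \<open>The sequences \<open>z\<close> and \<open>w\<close> are arbitrary, so one argument
  covers two columns from the same block as well as one from each block.\<close>

lemma scroll_minor_in_prime:
  assumes char: "prime CHAR('k)" "q = CHAR('k) ^ h" and q: "1 < q"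
    and z: "\<And>i. i \<le> q \<Longrightarrow> indets (z i) \<subseteq> V" and w: "\<And>i. i \<le> q \<Longrightarrow> indets (w i) \<subseteq> V"
    and fz: "\<And>i. 1 \<le> i \<Longrightarrow> i < q \<Longrightarrow> scroll_form z i \<in> Q"
    and fw: "\<And>i. 1 \<le> i \<Longrightarrow> i < q \<Longrightarrow> scroll_form w i \<in> Q"
    and zw: "z 0 * w q - z q * w 0 \<in> Q" and ij: "i < q" "j < q"
  shows "z i * w (Suc j) - z (Suc i) * w j \<in> Q"
proof -
  note [simp] = z w
  \<comment> \<open>When exactly one of \<open>z 0\<close>, \<open>w 0\<close> is in
    \<open>Q\<close>, the corner form loses one of its products, and the other product yields the
    missing \<open>z q\<close> or \<open>w q\<close>.\<close>
  have sub: "a \<in> Q" if "a * b - c * d \<in> Q" "c \<in> Q \<or> d \<in> Q" "b \<notin> Q" 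
    "indets a \<subseteq> V" "indets b \<subseteq> V" "indets c \<subseteq> V" "indets d \<subseteq> V" for a b c d
  proof -
    have "c * d \<in> Q" using that by (auto intro: Q_mult Q_mult')
    with that(1) have "a * b \<in> Q" using Q_add by fastforce
    with that show ?thesis using Q_prime by blast
  qed
  consider "z 0 \<in> Q" "w 0 \<in> Q" | "z 0 \<in> Q" "w 0 \<notin> Q" | "z 0 \<notin> Q" "w 0 \<in> Q" | "z 0 \<notin> Q" "w 0 \<notin> Q"
    by blast
  then show ?thesis
  proof cases
    case 1
    have "z i \<in> Q" "w j \<in> Q"
      by (rule scroll_forms_degenerate[of q]; use 1 z w fz fw ij in simp)+
    then show ?thesis using ij by (intro Q_diff Q_mult Q_mult') auto
  next
    case 2
    have "z q * w 0 - z 0 * w q \<in> Q"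
      using Q_diff[OF Q_zero zw] by simp
    then have "z q \<in> Q" by (rule sub) (use 2 in auto)
    then have "z k \<in> Q" if "k \<le> q" for k
      using scroll_forms_degenerate[of q z k] that z fz 2 by (cases "k = q") auto
    then show ?thesis using ij by (intro Q_diff Q_mult Q_mult') auto
  next
    case 3
    have "w q * z 0 - z q * w 0 \<in> Q"
      using zw by (simp add: mult.commute)
    then have "w q \<in> Q" by (rule sub) (use 3 in auto)
    then have "w k \<in> Q" if "k \<le> q" for k
      using scroll_forms_degenerate[of q w k] that w fw 3 by (cases "k = q") auto
    then show ?thesis using ij by (intro Q_diff Q_mult Q_mult') auto
  next
    case 4
    have cz: "eqv (z 0 ^ k * z k) (z 0 * z 1 ^ k)" if "k \<le> q" for k
      by (rule scroll_forms_curve'[of q]) (use 4 z fz that in auto)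
    have cw: "eqv (w 0 ^ k * w k) (w 0 * w 1 ^ k)" if "k \<le> q" for k
      by (rule scroll_forms_curve'[of q]) (use 4 w fw that in auto)
    \<comment> \<open>Here alone the characteristic enters: the corner form only compares
      \<open>q\<close>-th powers, and Frobenius makes their difference the \<open>q\<close>-th power
      of one minor.\<close>
    have frob: "(z 0 * w 1 - z 1 * w 0) ^ q = (z 0 * w 1) ^ q - (z 1 * w 0) ^ q"
      by (rule freshmans_dream_diff[of q h]) (simp_all add: CHAR_mpoly char)
    have "eqv (z 0 ^ q * w 0 ^ q * (z 0 * w q - z q * w 0))
       (z 0 * z 0 ^ q * (w 0 * w 1 ^ q) - w 0 * w 0 ^ q * (z 0 * z 1 ^ q))"
    proof -
      have "eqv (z 0 * z 0 ^ q * (w 0 ^ q * w q) - w 0 * w 0 ^ q * (z 0 ^ q * z q))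
        (z 0 * z 0 ^ q * (w 0 * w 1 ^ q) - w 0 * w 0 ^ q * (z 0 * z 1 ^ q))"
        using q by (intro eqv_diff eqv_mult cz cw eqv_refl) auto
      then show ?thesis by (simp add: algebra_simps)
    qed
    moreover have "z 0 ^ q * w 0 ^ q * (z 0 * w q - z q * w 0) \<in> Q"
      by (rule Q_mult[OF zw]) simp
    ultimately have "z 0 * z 0 ^ q * (w 0 * w 1 ^ q) - w 0 * w 0 ^ q * (z 0 * z 1 ^ q) \<in> Q"
      by (rule eqv_mem[OF eqv_sym])
    also have "z 0 * z 0 ^ q * (w 0 * w 1 ^ q) - w 0 * w 0 ^ q * (z 0 * z 1 ^ q) =
       z 0 ^ 1 * (w 0 ^ 1 * (z 0 * w 1 - z 1 * w 0) ^ q)"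
      unfolding frob by (simp add: power_mult_distrib algebra_simps)
    finally have *: "z 0 ^ 1 * (w 0 ^ 1 * (z 0 * w 1 - z 1 * w 0) ^ q) \<in> Q" .
    have "z 0 * w 1 - z 1 * w 0 \<in> Q"
    proof -
      have "w 0 ^ 1 * (z 0 * w 1 - z 1 * w 0) ^ q \<in> Q"
        by (rule Q_cancel[OF _ _ _ *]) (use 4 q in auto)
      then have "(z 0 * w 1 - z 1 * w 0) ^ q \<in> Q"
        by (rule Q_cancel[of "w 0" _ 1, rotated 3]) (use 4 q in auto)
      then show ?thesis
        by (rule Q_power[of _ q, rotated]) (use q in auto)
    qed
    \<comment> \<open>On the curves \<open>z i = a * s ^ i\<close>, \<open>w j = b * t ^ j\<close>
      the minor is \<open>a * b * s ^ i * t ^ j * (t - s)\<close>. This multiple of the first minor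
      is that expression with denominators cleared.\<close>
    then have "z 0 * w 0 * (z 1 ^ i * w 1 ^ j) * (z 0 * w 1 - z 1 * w 0) \<in> Q"
      using q by (intro Q_mult) auto
    also have "z 0 * w 0 * (z 1 ^ i * w 1 ^ j) * (z 0 * w 1 - z 1 * w 0) =
       z 0 * (z 0 * z 1 ^ i) * (w 0 * w 1 ^ Suc j) - (z 0 * z 1 ^ Suc i) * (w 0 * (w 0 * w 1 ^ j))"
      by (simp add: algebra_simps)
    finally have "\<dots> \<in> Q" .
    moreover have "eqv (z 0 * (z 0 ^ i * z i) * (w 0 ^ Suc j * w (Suc j)) - (z 0 ^ Suc i * z (Suc i)) * (w 0 * (w 0 ^ j * w j)))
       (z 0 * (z 0 * z 1 ^ i) * (w 0 * w 1 ^ Suc j) - (z 0 * z 1 ^ Suc i) * (w 0 * (w 0 * w 1 ^ j)))"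
      using q ij by (intro eqv_diff eqv_mult cz cw eqv_refl) auto
    ultimately have "z 0 * (z 0 ^ i * z i) * (w 0 ^ Suc j * w (Suc j)) - (z 0 ^ Suc i * z (Suc i)) * (w 0 * (w 0 ^ j * w j)) \<in> Q"
      by (rule eqv_mem[rotated])
    also have "z 0 * (z 0 ^ i * z i) * (w 0 ^ Suc j * w (Suc j)) - (z 0 ^ Suc i * z (Suc i)) * (w 0 * (w 0 ^ j * w j))
      = z 0 ^ Suc i * (w 0 ^ Suc j * (z i * w (Suc j) - z (Suc i) * w j))"
      by (simp add: algebra_simps)
    finally have "w 0 ^ Suc j * (z i * w (Suc j) - z (Suc i) * w j) \<in> Q"
        by (rule Q_cancel[of "z 0" _ "Suc i", rotated 3]) (use 4 q ij in auto)
    then show ?thesis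
      by (rule Q_cancel[of "w 0" _ "Suc j", rotated 3]) (use 4 q ij in auto)
  qed
qed

end

section \<open>The scroll ideal as a kernel\<close>

lemma det_dim_two:
  fixes A :: "'a::comm_ring_1 mat"
  assumes A: "A \<in> carrier_mat 2 2"
  shows "det A = A $$ (0, 0) * A $$ (1, 1) - A $$ (0, 1) * A $$ (1, 0)"
proof -
  have 1: "det (mat_delete A i 0) = A $$ (1 - i, 1)" if "i < 2" for i
    using A that by (subst det_single) (auto simp: mat_delete_def less_2_cases_iff)
  have "det A = (\<Sum>i<2. A $$ (i, 0) * cofactor A i 0)"
    by (rule laplace_expansion_column[OF A]) simp
  then show ?thesis
    by (simp add: numeral_2_eq_2 cofactor_def 1[simplified numeral_2_eq_2])
qed

lemma pick_two:
  assumes "a < b"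
  shows "pick {a, b} 0 = a" "pick {a, b} (Suc 0) = b"
proof -
  show 0: "pick {a, b} 0 = a"
    using assms by (auto intro!: Least_equality)
  show "pick {a, b} (Suc 0) = b"
    unfolding pick.simps(2) 0 using assms by (auto intro!: Least_equality)
qed

text \<open>The row set is forced, and a column set of two elements has a unique increasing
  enumeration, which is the order that \<open>pick\<close> uses.\<close>

lemma minors_two_rows:
  assumes A: "dim_row A = 2"
  shows "minors 2 A = {A $$ (0, a) * A $$ (1, b) - A $$ (0, b) * A $$ (1, a) | a b. a < b \<and> b < dim_col A}"
proof -
  have *: "det (submatrix A I {a, b}) = A $$ (0, a) * A $$ (1, b) - A $$ (0, b) * A $$ (1, a)"
    if "I = {0, 1}" "a < b" "b < dim_col A" for I a b
  proof -
    have r: "{i. i < dim_row A \<and> i \<in> I} = {0, 1}" using A that by auto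
    have c: "{j. j < dim_col A \<and> j \<in> {a, b}} = {a, b}" using that by auto
    have dims: "submatrix A I {a, b} \<in> carrier_mat 2 2"
    proof (rule carrier_matI)
      show "dim_row (submatrix A I {a, b}) = 2"
        unfolding dim_submatrix r by simp
      show "dim_col (submatrix A I {a, b}) = 2"
        unfolding dim_submatrix c using that(2) by simp
    qed
    have e: "submatrix A I {a, b} $$ (i, j) = A $$ (pick I i, pick {a, b} j)" if "i < 2" "j < 2" for i j
    proof (rule submatrix_index)
      show "i < card {i. i < dim_row A \<and> i \<in> I}"
        unfolding r using that by simp
      show "j < card {j. j < dim_col A \<and> j \<in> {a, b}}"
        unfolding c using that \<open>a < b\<close> by simp
    qed
    have p: "pick I 0 = 0" "pick I (Suc 0) = 1"
      using pick_two[of 0 1] that(1) by auto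
    show ?thesis
      by (simp add: det_dim_two[OF dims] e p pick_two[OF that(2)] del: pick.simps)
  qed
  have rows: "I = {0, 1}" if "I \<subseteq> {..<2}" "card I = 2" for I :: "nat set"
  proof -
    have "I = {..<2}" by (rule card_subset_eq) (use that in auto)
    then show ?thesis by auto
  qed
  show ?thesis
  proof (intro equalityI subsetI)
    fix f assume "f \<in> minors 2 A"
    then obtain I J where IJ: "f = det (submatrix A I J)" "I \<subseteq> {..<2}" "J \<subseteq> {..<dim_col A}" "card I = 2" "card J = 2"
      unfolding minors_def A by blast
    obtain x y where xy: "J = {x, y}" "x \<noteq> y"
      using IJ(5) by (auto simp: card_2_iff)
    define a b where "a = min x y" and "b = max x y"
    have ab: "J = {a, b}" "a < b"
      using xy by (auto simp: a_def b_def min_def max_def)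
    then have "b < dim_col A" using IJ(3) by auto
    then show "f \<in> {A $$ (0, a) * A $$ (1, b) - A $$ (0, b) * A $$ (1, a) | a b. a < b \<and> b < dim_col A}"
      using *[OF rows[OF IJ(2,4)] ab(2)] IJ(1) ab by auto
  next
    fix f assume "f \<in> {A $$ (0, a) * A $$ (1, b) - A $$ (0, b) * A $$ (1, a) | a b. a < b \<and> b < dim_col A}"
    then obtain a b where ab: "a < b" "b < dim_col A" "f = A $$ (0, a) * A $$ (1, b) - A $$ (0, b) * A $$ (1, a)"
      by blast
    then have "f = det (submatrix A {0, 1} {a, b})" using * by auto
    moreover have "{0, 1} \<subseteq> {..<dim_row A}" "{a, b} \<subseteq> {..<dim_col A}" "card {0::nat, 1} = 2" "card {a, b} = 2"
      using ab A by auto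
    ultimately show "f \<in> minors 2 A" unfolding minors_def by blast
  qed
qed

text \<open>The number of the top entry of column \<open>c\<close>; the bottom entry has the next
  number. The number \<open>q\<close> is skipped because \<open>x_q\<close> occurs only in the
  bottom row.\<close>

definition column_var :: "nat \<Rightarrow> nat \<Rightarrow> nat" where
  "column_var q c = (if c < q then c else Suc c)"

lemma scroll_minors:
  "minors 2 (scroll_matrix q :: 'k::comm_ring_1 mpoly mat) =
     {Var (column_var q a) * Var (Suc (column_var q b)) - Var (column_var q b) * Var (Suc (column_var q a))
       | a b. a < b \<and> b < 2 * q}"
proof -
  have dims: "dim_row (scroll_matrix q :: 'k mpoly mat) = 2" "dim_col (scroll_matrix q :: 'k mpoly mat) = 2 * q"
    by (simp_all add: scroll_matrix_def)
  have entries: "(scroll_matrix q :: 'k mpoly mat) $$ (0, c) = Var (column_var q c)"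
     "(scroll_matrix q :: 'k mpoly mat) $$ (1, c) = Var (Suc (column_var q c))" if "c < 2 * q" for c
    using that by (simp_all add: scroll_matrix_def column_var_def xvar_def yvar_def)
  show ?thesis
    unfolding minors_two_rows[OF dims(1)] dims(2)
    by (intro Collect_cong ex_cong1) (auto simp: entries[simplified])
qed

lemma column_var_less: "c < 2 * q \<Longrightarrow> Suc (column_var q c) < 2 * q + 2"
  by (auto simp: column_var_def)

lemma scroll_minors_subset: "minors 2 (scroll_matrix q :: 'k::comm_ring_1 mpoly mat) \<subseteq> polys_in {..<2 * q + 2}"
proof
  fix f :: "'k mpoly" assume "f \<in> minors 2 (scroll_matrix q)"
  then obtain a b where f: "f = Var (column_var q a) * Var (Suc (column_var q b)) - Var (column_var q b) * Var (Suc (column_var q a))"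
    and ab: "a < b" "b < 2 * q"
    unfolding scroll_minors by blast
  show "f \<in> polys_in {..<2 * q + 2}"
    using column_var_less[of a q] column_var_less[of b q] ab unfolding f
    by (simp add: indets_diff_subset)
qed

lemma ideal_scroll_ideal: "ideal (scroll_ideal q :: 'k::comm_ring_1 mpoly set) (mpoly_ring {..<2 * q + 2})"
proof -
  interpret cring "mpoly_ring {..<2 * q + 2} :: 'k mpoly ring" by (rule cring_mpoly_ring)
  show ?thesis
    unfolding scroll_ideal_def scroll_ring_def
    by (rule genideal_ideal) (use scroll_minors_subset in simp)
qed

section \<open>Straightening monomials modulo the minors\<close>

definition var_index :: "nat \<Rightarrow> nat \<Rightarrow> nat" where
  "var_index q v = (if v \<le> q then v else v - (q + 1))"

text \<open>One unit of index moves from \<open>v\<close> to \<open>u\<close>. The bounds on the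
  indices say that \<open>u\<close> heads some column and \<open>v\<close> ends some column; up to
  sign the difference is the minor of these two columns.\<close>

lemma scroll_swap:
  assumes "u < 2 * q + 2" "v < 2 * q + 2" "var_index q u < q" "0 < var_index q v"
  shows "Var u * Var v - Var (Suc u) * Var (v - 1) \<in> (scroll_ideal q :: 'k::comm_ring_1 mpoly set)"
proof -
  interpret cring "mpoly_ring {..<2 * q + 2} :: 'k mpoly ring" by (rule cring_mpoly_ring)
  have gen: "minors 2 (scroll_matrix q) \<subseteq> (scroll_ideal q :: 'k mpoly set)"
    unfolding scroll_ideal_def scroll_ring_def
    by (rule genideal_self) (use scroll_minors_subset in simp)
  note I = ideal_mpoly_ringD[OF ideal_scroll_ideal[of q, where 'k = 'k]]
  have minor: "Var (column_var q a) * Var (Suc (column_var q b)) - Var (column_var q b) * Var (Suc (column_var q a)) \<in> (scroll_ideal q :: 'k mpoly set)"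
    if "a < b" "b < 2 * q" for a b
    using gen that unfolding scroll_minors by blast
  obtain a where a: "a < 2 * q" "u = column_var q a"
  proof
    show "(if u \<le> q then u else u - 1) < 2 * q" "u = column_var q (if u \<le> q then u else u - 1)"
      using assms by (auto simp: var_index_def column_var_def split: if_splits)
  qed
  obtain b where b: "b < 2 * q" "v = Suc (column_var q b)"
  proof
    show "(if v \<le> q then v - 1 else v - 2) < 2 * q" "v = Suc (column_var q (if v \<le> q then v - 1 else v - 2))"
      using assms by (auto simp: var_index_def column_var_def split: if_splits)
  qed
  \<comment> \<open>Reversing the columns only changes the sign, and equal columns give 0.\<close>
  consider "a < b" | "a = b" | "b < a" by linarith
  then show ?thesis
  proof cases
    case 1
    with minor[OF 1] a b show ?thesis by (simp add: mult.commute)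
  next
    case 2
    with a b show ?thesis using I(2) by (simp add: mult.commute)
  next
    case 3
    with I(5)[OF I(2) minor[OF 3]] a b show ?thesis by (simp add: mult.commute)
  qed
qed

text \<open>Monomials as multisets of factors, so that single factors can be exchanged and split
  off.\<close>

definition var_prod :: "nat multiset \<Rightarrow> 'k::comm_ring_1 mpoly" where
  "var_prod M = prod_mset (image_mset Var M)"

lemma var_prod_simps [simp]:
  "var_prod {#} = 1" "var_prod (add_mset v M) = Var v * var_prod M"
  by (simp_all add: var_prod_def)

lemma indets_var_prod: "set_mset M \<subseteq> V \<Longrightarrow> indets (var_prod M :: 'k::comm_ring_1 mpoly) \<subseteq> V"
  by (induction M) auto

text \<open>These numbers determine the exponents of the image monomial under the parametrization:
  the degrees in \<open>x\<close> and \<open>y\<close> and the index sum.\<close>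

definition same_signature :: "nat \<Rightarrow> nat multiset \<Rightarrow> nat multiset \<Rightarrow> bool" where
  "same_signature q M N \<longleftrightarrow>
     size (filter_mset (\<lambda>v. v \<le> q) M) = size (filter_mset (\<lambda>v. v \<le> q) N) \<and>
     size M = size N \<and>
     sum_mset (image_mset (var_index q) M) = sum_mset (image_mset (var_index q) N)"

lemma sum_var_index_le:
  "(\<And>v. v \<in># M \<Longrightarrow> var_index q v \<le> q) \<Longrightarrow> sum_mset (image_mset (var_index q) M) \<le> q * size M"
  by (induction M) (force simp: algebra_simps)+

lemma sum_var_index_eq:
  "(\<And>v. v \<in># M \<Longrightarrow> var_index q v = c) \<Longrightarrow> sum_mset (image_mset (var_index q) M) = c * size M"
  by (induction M) (auto simp: algebra_simps)

text \<open>The index of a factor can be moved step by step towards any index that occurs in another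
  monomial of the same signature, because the remaining factors can absorb the difference.\<close>

lemma expose_variable:
  assumes "set_mset (add_mset u M) \<subseteq> {..<2 * q + 2}" "set_mset (add_mset v M') \<subseteq> {..<2 * q + 2}"
    and "u \<le> q \<longleftrightarrow> v \<le> q" "same_signature q (add_mset u M) (add_mset v M')"
  shows "\<exists>N. set_mset N \<subseteq> {..<2 * q + 2} \<and> same_signature q (add_mset v N) (add_mset v M') \<and>
    var_prod (add_mset u M) - var_prod (add_mset v N) \<in> (scroll_ideal q :: 'k::comm_ring_1 mpoly set)"
  using assms
\<comment> \<open>The measure is the distance of \<open>u\<close> and \<open>v\<close>, written with
  truncated subtraction.\<close>
proof (induction "(u - v) + (v - u)" arbitrary: u M rule: less_induct)
  case less
  note I = ideal_mpoly_ringD[OF ideal_scroll_ideal[of q, where 'k = 'k]]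
  have idx_le: "var_index q w \<le> q" if "w < 2 * q + 2" for w
    using that by (auto simp: var_index_def)
  \<comment> \<open>Both variables lie in the same block, so their numbers differ as their indices
    do.\<close>
  have idx: "var_index q u + v = var_index q v + u"
    using less.prems(3) by (auto simp: var_index_def)
  have step: ?case
    if N: "set_mset (add_mset u' N) \<subseteq> {..<2 * q + 2}" and u': "u' \<le> q \<longleftrightarrow> v \<le> q"
      "same_signature q (add_mset u' N) (add_mset v M')" "(u' - v) + (v - u') < (u - v) + (v - u)"
      and eq: "var_prod (add_mset u M) - var_prod (add_mset u' N) \<in> (scroll_ideal q :: 'k mpoly set)"
    for u' N
  proof -
    obtain N' where "set_mset N' \<subseteq> {..<2 * q + 2}" "same_signature q (add_mset v N') (add_mset v M')"
      "var_prod (add_mset u' N) - var_prod (add_mset v N') \<in> (scroll_ideal q :: 'k mpoly set)"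
      using less.hyps[OF u'(3) N less.prems(2) u'(1,2)] by blast
    with I(3)[OF eq] show ?thesis by (intro exI[of _ N']) force
  qed
  have sizes: "size M = size M'"
    "var_index q u + sum_mset (image_mset (var_index q) M) = var_index q v + sum_mset (image_mset (var_index q) M')"
    using less.prems(4) by (auto simp: same_signature_def)
  consider "u = v" | "u < v" | "v < u" by linarith
  then show ?case
  proof cases
    case 1
    then show ?thesis using less.prems I(2) by (intro exI[of _ M]) auto
  next
    case 2
    \<comment> \<open>If all other factors had index 0, the index sum would be that of
      \<open>u\<close>, too small for a monomial containing \<open>v\<close>.\<close>
    have "\<exists>w\<in>#M. 0 < var_index q w"
    proof (rule ccontr)
      assume "\<not> ?thesis"
      then have "sum_mset (image_mset (var_index q) M) = 0"
        using sum_var_index_eq[of M q 0] by auto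
      with sizes(2) idx 2 show False by linarith
    qed
    then obtain w K where w: "M = add_mset w K" "0 < var_index q w"
      by (metis multi_member_split)
    have bounds: "w < 2 * q + 2" "u < 2 * q + 2" "v < 2 * q + 2" "set_mset K \<subseteq> {..<2 * q + 2}"
      using less.prems w by auto
    have u: "var_index q u < q" using idx_le[of v] idx 2 bounds by linarith
    have "var_prod K * (Var u * Var w - Var (Suc u) * Var (w - 1)) \<in> (scroll_ideal q :: 'k mpoly set)"
      by (intro I(4) scroll_swap bounds u w(2) indets_var_prod)
    then have eq: "var_prod (add_mset u M) - var_prod (add_mset (Suc u) (add_mset (w - 1) K)) \<in> (scroll_ideal q :: 'k mpoly set)"
      by (simp add: w algebra_simps)
    have "Suc u \<le> q \<longleftrightarrow> u \<le> q" "var_index q (Suc u) = Suc (var_index q u)"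
      using less.prems(3) 2 by (auto simp: var_index_def split: if_splits)
    moreover have "w - 1 \<le> q \<longleftrightarrow> w \<le> q" "var_index q w = Suc (var_index q (w - 1))"
      using w(2) by (auto simp: var_index_def split: if_splits)
    ultimately show ?thesis
      using less.prems 2 bounds
      by (intro step[OF _ _ _ _ eq]) (auto simp: same_signature_def w(1))
  next
    case 3
    \<comment> \<open>If all other factors had the top index, the sum would be too large, since
      \<open>M\<close> and \<open>M'\<close> have the same size.\<close>
    have "\<exists>w\<in>#M. var_index q w < q"
    proof (rule ccontr)
      assume no: "\<not> ?thesis"
      have "var_index q w = q" if "w \<in># M" for w
      proof -
        have "w < 2 * q + 2" using that less.prems(1) by auto
        with idx_le[of w] no that show ?thesis by force
      qed
      then have "sum_mset (image_mset (var_index q) M) = q * size M"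
        using sum_var_index_eq[of M q q] by auto
      moreover have "sum_mset (image_mset (var_index q) M') \<le> q * size M'"
        using less.prems(2) idx_le by (intro sum_var_index_le) auto
      ultimately show False using sizes idx 3 by simp
    qed
    then obtain w K where w: "M = add_mset w K" "var_index q w < q"
      by (metis multi_member_split)
    have bounds: "w < 2 * q + 2" "u < 2 * q + 2" "v < 2 * q + 2" "set_mset K \<subseteq> {..<2 * q + 2}"
      using less.prems w by auto
    have u: "0 < var_index q u" using idx 3 by linarith
    have "var_prod K * (Var w * Var u - Var (Suc w) * Var (u - 1)) \<in> (scroll_ideal q :: 'k mpoly set)"
      by (intro I(4) scroll_swap bounds u w(2) indets_var_prod)
    then have eq: "var_prod (add_mset u M) - var_prod (add_mset (u - 1) (add_mset (Suc w) K)) \<in> (scroll_ideal q :: 'k mpoly set)"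
      by (simp add: w algebra_simps)
    have "Suc w \<le> q \<longleftrightarrow> w \<le> q" "var_index q (Suc w) = Suc (var_index q w)" "Suc w < 2 * q + 2"
      using w(2) bounds by (auto simp: var_index_def split: if_splits)
    moreover have "u - 1 \<le> q \<longleftrightarrow> u \<le> q" "var_index q u = Suc (var_index q (u - 1))"
      using u by (auto simp: var_index_def split: if_splits)
    ultimately show ?thesis
      using less.prems 3 bounds
      by (intro step[OF _ _ _ _ eq]) (auto simp: same_signature_def w(1))
  qed
qed

text \<open>Induction on the degree: a factor \<open>v\<close> of \<open>N\<close> is exposed in
  \<open>M\<close>, and after its removal the cofactors again have equal signatures.\<close>

lemma same_signature_cong:
  assumes "set_mset M \<subseteq> {..<2 * q + 2}" "set_mset N \<subseteq> {..<2 * q + 2}" "same_signature q M N"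
  shows "var_prod M - var_prod N \<in> (scroll_ideal q :: 'k::comm_ring_1 mpoly set)"
  using assms
proof (induction "size M" arbitrary: M N)
  case 0
  then show ?case
    using ideal_mpoly_ringD(2)[OF ideal_scroll_ideal[of q, where 'k = 'k]]
    by (auto simp: same_signature_def)
next
  case (Suc n)
  note I = ideal_mpoly_ringD[OF ideal_scroll_ideal[of q, where 'k = 'k]]
  obtain u M1 where M: "M = add_mset u M1"
    using Suc.hyps(2) by (metis size_eq_Suc_imp_eq_union)
  \<comment> \<open>Equal degrees in each block give \<open>N\<close> a factor from the block of
    \<open>u\<close>.\<close>
  have "\<exists>v\<in>#N. v \<le> q \<longleftrightarrow> u \<le> q"
  proof (rule ccontr)
    assume no: "\<not> ?thesis"
    show False
    proof (cases "u \<le> q")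
      case True
      then have "filter_mset (\<lambda>v. v \<le> q) N = {#}" using no by (auto simp: filter_mset_eq_conv)
      with Suc.prems(3) M True show False by (simp add: same_signature_def)
    next
      case False
      then have "filter_mset (\<lambda>v. v \<le> q) N = N" using no by (auto simp: filter_mset_eq_conv)
      moreover have "size (filter_mset (\<lambda>v. v \<le> q) M) \<le> size M1"
        using False M size_filter_mset_lesseq[of "\<lambda>v. v \<le> q" M1] by simp
      ultimately show False
        using Suc.prems(3) M by (simp add: same_signature_def)
    qed
  qed
  then obtain v N1 where N: "N = add_mset v N1" "v \<le> q \<longleftrightarrow> u \<le> q"
    by (metis multi_member_split)
  obtain K where K: "set_mset K \<subseteq> {..<2 * q + 2}" "same_signature q (add_mset v K) N"
    "var_prod M - var_prod (add_mset v K) \<in> (scroll_ideal q :: 'k mpoly set)"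
    using expose_variable[of u M1 q v N1] Suc.prems M N by auto
  have "size N = size M" using Suc.prems(3) by (simp add: same_signature_def)
  with K(2) Suc.hyps(2) have "n = size K" by (simp add: same_signature_def)
  moreover have "same_signature q K N1"
    using K(2) unfolding N by (auto simp: same_signature_def split: if_splits)
  ultimately have "var_prod K - var_prod N1 \<in> (scroll_ideal q :: 'k mpoly set)"
    using Suc.hyps(1)[of K N1] K(1) Suc.prems N by auto
  then have "Var v * (var_prod K - var_prod N1) \<in> (scroll_ideal q :: 'k mpoly set)"
    by (rule I(4)) (use Suc.prems N in auto)
  from I(3)[OF K(3) this] show ?case by (simp add: N algebra_simps)
qed

text \<open>The parameters \<open>a\<close>, \<open>s\<close>, \<open>b\<close> are realized by the
  indeterminates numbered \<open>0\<close>, \<open>1\<close> and \<open>q + 1\<close>. Thus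
  \<open>x_0\<close> and \<open>y_0\<close> stay fixed, and partial parametrizations make sense
  inside the same ring.\<close>

definition scroll_param :: "nat \<Rightarrow> nat \<Rightarrow> 'k::comm_ring_1 mpoly" where
  "scroll_param q v = Var (if v \<le> q then 0 else q + 1) * Var 1 ^ var_index q v"

lemma poly_subst_scroll_param_var_prod:
  "poly_subst (scroll_param q) (var_prod M :: 'k::comm_ring_1 mpoly) =
     Poly_Mapping.single (Poly_Mapping.single 0 (size (filter_mset (\<lambda>v. v \<le> q) M)) +
       Poly_Mapping.single (q + 1) (size (filter_mset (\<lambda>v. \<not> v \<le> q) M)) +
       Poly_Mapping.single 1 (sum_mset (image_mset (var_index q) M))) 1"
proof (induction M)
  case (add v M)
  have param: "(scroll_param q v :: 'k mpoly) =
     Poly_Mapping.single (Poly_Mapping.single (if v \<le> q then 0 else q + 1) 1 + Poly_Mapping.single 1 (var_index q v)) 1"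
    by (simp add: scroll_param_def Var_power) (simp add: Var_def mult_single)
  have Suc: "Poly_Mapping.single x (Suc n) = Poly_Mapping.single x 1 + Poly_Mapping.single x n" for x n :: nat
    by (simp flip: single_add)
  show ?case
    by (simp add: param poly_subst_mult add.IH mult_single single_add Suc[of _ "size _"] add_ac)
qed simp

text \<open>The signature is read off from the exponents; \<open>0 < q\<close> keeps the
  indeterminates \<open>1\<close> and \<open>q + 1\<close> apart.\<close>

lemma same_signature_if_same_image:
  assumes "0 < q" "poly_subst (scroll_param q) (var_prod M :: 'k::comm_ring_1 mpoly) =
     poly_subst (scroll_param q) (var_prod N)"
  shows "same_signature q M N"
proof -
  let ?e = "\<lambda>M. Poly_Mapping.single 0 (size (filter_mset (\<lambda>v. v \<le> q) M)) +
       Poly_Mapping.single (q + 1) (size (filter_mset (\<lambda>v. \<not> v \<le> q) M)) +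
       Poly_Mapping.single 1 (sum_mset (image_mset (var_index q) M))"
  have "Poly_Mapping.keys (Poly_Mapping.single (?e M) (1::'k)) = Poly_Mapping.keys (Poly_Mapping.single (?e N) (1::'k))"
    using assms(2) unfolding poly_subst_scroll_param_var_prod by simp
  then have e: "?e M = ?e N" by simp
  have "Poly_Mapping.lookup (?e M) i = Poly_Mapping.lookup (?e N) i" for i
    by (simp only: e)
  from this[of 0] this[of "q + 1"] this[of 1]
  have "size (filter_mset (\<lambda>v. v \<le> q) M) = size (filter_mset (\<lambda>v. v \<le> q) N)"
    "size (filter_mset (\<lambda>v. \<not> v \<le> q) M) = size (filter_mset (\<lambda>v. \<not> v \<le> q) N)"
    "sum_mset (image_mset (var_index q) M) = sum_mset (image_mset (var_index q) N)"
    using assms(1) by (simp_all add: lookup_add lookup_single when_def)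
  moreover have "size (filter_mset (\<lambda>v. v \<le> q) M) + size (filter_mset (\<lambda>v. \<not> v \<le> q) M) = size M" for M
    by (induction M) auto
  from this[of M] this[of N] calculation show ?thesis by (simp add: same_signature_def)
qed

lemma single_eq_var_prod:
  obtains M where "set_mset M = Poly_Mapping.keys m" "Poly_Mapping.single m 1 = (var_prod M :: 'k::comm_ring_1 mpoly)"
proof
  define M where "M = (\<Sum>v\<in>Poly_Mapping.keys m. replicate_mset (Poly_Mapping.lookup m v) v)"
  show "set_mset M = Poly_Mapping.keys m"
    by (auto simp: M_def set_mset_sum in_keys_iff split: if_splits)
  have "var_prod (\<Sum>v\<in>A. replicate_mset (Poly_Mapping.lookup m v) v) =
      (\<Prod>v\<in>A. Var v ^ Poly_Mapping.lookup m v :: 'k mpoly)" if "finite A" for A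
    using that by (induction rule: finite_induct) (simp_all add: var_prod_def)
  then have "(var_prod M :: 'k mpoly) = monom_eval Var m"
    by (simp add: M_def monom_eval_def)
  then show "Poly_Mapping.single m 1 = (var_prod M :: 'k mpoly)"
    by (simp add: monom_eval_Var)
qed

text \<open>For the harder inclusion, a linear map sends each image monomial back to a chosen
  monomial above it. Going forth and back changes \<open>f\<close> only by an element of the ideal,
  and it yields 0 if \<open>f\<close> is in the kernel.\<close>

lemma scroll_ideal_eq_kernel:
  assumes "0 < q"
  shows "(scroll_ideal q :: 'k::idom mpoly set) = subst_kernel {..<2 * q + 2} (scroll_param q)"
proof
  interpret cring "mpoly_ring {..<2 * q + 2} :: 'k mpoly ring" by (rule cring_mpoly_ring)
  have "minors 2 (scroll_matrix q) \<subseteq> (subst_kernel {..<2 * q + 2} (scroll_param q) :: 'k mpoly set)"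
  proof
    fix f :: "'k mpoly" assume f: "f \<in> minors 2 (scroll_matrix q)"
    then obtain a b where ab: "a < b" "b < 2 * q"
      "f = Var (column_var q a) * Var (Suc (column_var q b)) - Var (column_var q b) * Var (Suc (column_var q a))"
      unfolding scroll_minors by blast
    \<comment> \<open>The bottom row of the parametrized matrix is \<open>s\<close> times the top
      row.\<close>
    have s: "scroll_param q (Suc (column_var q c)) = (scroll_param q (column_var q c) * Var 1 :: 'k mpoly)" for c
      by (auto simp: scroll_param_def column_var_def var_index_def Suc_diff_le)
    have "poly_subst (scroll_param q) f = 0"
      by (simp add: ab(3) poly_subst_diff poly_subst_mult s)
    with f scroll_minors_subset[of q] show "f \<in> subst_kernel {..<2 * q + 2} (scroll_param q)"
      by (auto simp: subst_kernel_def)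
  qed
  then show "scroll_ideal q \<subseteq> (subst_kernel {..<2 * q + 2} (scroll_param q) :: 'k mpoly set)"
    unfolding scroll_ideal_def scroll_ring_def
    by (intro genideal_minimal primeideal_mpoly_ringD(1)[OF primeideal_subst_kernel])
next
  let ?V = "{..<2 * q + 2}"
  let ?\<phi> = "poly_subst (scroll_param q) :: 'k mpoly \<Rightarrow> 'k mpoly"
  note I = ideal_mpoly_ringD[OF ideal_scroll_ideal[of q, where 'k = 'k]]
  define r :: "(nat \<Rightarrow>\<^sub>0 nat) \<Rightarrow> 'k mpoly" where
    "r e = (SOME g. \<exists>M. set_mset M \<subseteq> ?V \<and> g = var_prod M \<and> ?\<phi> (var_prod M) = Poly_Mapping.single e 1)" for e
  have single: "Poly_Mapping.single m c - linear_extension r (?\<phi> (Poly_Mapping.single m c)) \<in> scroll_ideal q"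
    if m: "Poly_Mapping.keys m \<subseteq> ?V" for m and c :: 'k
  proof -
    obtain M where M: "set_mset M = Poly_Mapping.keys m" "Poly_Mapping.single m 1 = (var_prod M :: 'k mpoly)"
      by (rule single_eq_var_prod)
    obtain e where e: "?\<phi> (var_prod M) = Poly_Mapping.single e 1"
      using poly_subst_scroll_param_var_prod by blast
    have "\<exists>g M. set_mset M \<subseteq> ?V \<and> g = (var_prod M :: 'k mpoly) \<and> ?\<phi> (var_prod M) = Poly_Mapping.single e 1"
      using M(1) m e by auto
    then have "\<exists>M. set_mset M \<subseteq> ?V \<and> r e = var_prod M \<and> ?\<phi> (var_prod M) = Poly_Mapping.single e 1"
      unfolding r_def by (rule someI_ex)
    then obtain N where N: "set_mset N \<subseteq> ?V" "r e = var_prod N" "?\<phi> (var_prod N) = Poly_Mapping.single e 1"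
      by blast
    have diff: "var_prod M - var_prod N \<in> (scroll_ideal q :: 'k mpoly set)"
      using M(1) m N e by (intro same_signature_cong same_signature_if_same_image[where 'k = 'k] assms) auto
    have mc: "Poly_Mapping.single m c = Poly_Mapping.single 0 c * (var_prod M :: 'k mpoly)"
      by (simp add: mult_single flip: M(2))
    have "?\<phi> (Poly_Mapping.single m c) = Poly_Mapping.single e c"
      unfolding mc by (simp add: poly_subst_mult e mult_single)
    then have "Poly_Mapping.single m c - linear_extension r (?\<phi> (Poly_Mapping.single m c)) =
        Poly_Mapping.single 0 c * (var_prod M - var_prod N)"
      by (simp add: mc linear_extension_single N(2) right_diff_distrib)
    then show ?thesis using I(4)[OF diff, of "Poly_Mapping.single 0 c"] by simp
  qed
  show "(subst_kernel ?V (scroll_param q) :: 'k mpoly set) \<subseteq> scroll_ideal q"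
  proof
    fix f :: "'k mpoly" assume f: "f \<in> subst_kernel ?V (scroll_param q)"
    have sum_mem: "sum g A \<in> scroll_ideal q" if "\<And>a. a \<in> A \<Longrightarrow> g a \<in> scroll_ideal q" for g :: "(nat \<Rightarrow>\<^sub>0 nat) \<Rightarrow> 'k mpoly" and A
      using that by (induction A rule: infinite_finite_induct) (simp_all add: I(2,3))
    have "f - linear_extension r (?\<phi> f) = (\<Sum>m\<in>Poly_Mapping.keys f. Poly_Mapping.single m (Poly_Mapping.lookup f m)
        - linear_extension r (?\<phi> (Poly_Mapping.single m (Poly_Mapping.lookup f m))))"
      by (subst (1 2) mpoly_expansion[of f]) (simp only: poly_subst_sum linear_extension_sum sum_subtractf)
    also have "\<dots> \<in> scroll_ideal q"
      using f by (intro sum_mem single) (auto simp: subst_kernel_def indets_def)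
    finally show "f \<in> scroll_ideal q"
      using f by (simp add: subst_kernel_def)
  qed
qed

section \<open>Chains of prime ideals\<close>

definition exponent_box :: "nat set \<Rightarrow> nat \<Rightarrow> (nat \<Rightarrow>\<^sub>0 nat) set" where
  "exponent_box A D = {e. Poly_Mapping.keys e \<subseteq> A \<and> (\<forall>v. Poly_Mapping.lookup e v < D)}"

lemma finite_card_exponent_box:
  assumes A: "finite A" and D: "0 < D"
  shows "finite (exponent_box A D) \<and> card (exponent_box A D) = D ^ card A"
proof -
  have "bij_betw (\<lambda>e. restrict (Poly_Mapping.lookup e) A) (exponent_box A D) (A \<rightarrow>\<^sub>E {..<D})"
  proof (rule bij_betwI')
    fix e e' assume e: "e \<in> exponent_box A D" "e' \<in> exponent_box A D"
    show "restrict (Poly_Mapping.lookup e) A = restrict (Poly_Mapping.lookup e') A \<longleftrightarrow> e = e'"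
    proof
      assume eq: "restrict (Poly_Mapping.lookup e) A = restrict (Poly_Mapping.lookup e') A"
      show "e = e'"
      proof (rule poly_mapping_eqI)
        fix v
        show "Poly_Mapping.lookup e v = Poly_Mapping.lookup e' v"
        proof (cases "v \<in> A")
          case True
          then show ?thesis using fun_cong[OF eq, of v] by simp
        next
          case False
          then have "v \<notin> Poly_Mapping.keys e" "v \<notin> Poly_Mapping.keys e'"
            using e by (auto simp: exponent_box_def)
          then show ?thesis by (simp add: in_keys_iff)
        qed
      qed
    qed simp
  next
    fix e assume "e \<in> exponent_box A D"
    then show "restrict (Poly_Mapping.lookup e) A \<in> A \<rightarrow>\<^sub>E {..<D}"
      by (auto simp: exponent_box_def)
  next
    fix g assume g: "g \<in> A \<rightarrow>\<^sub>E {..<D}"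
    have "finite {v. (if v \<in> A then g v else 0) \<noteq> 0}"
      by (rule finite_subset[OF _ A]) auto
    then have l: "Poly_Mapping.lookup (Abs_poly_mapping (\<lambda>v. if v \<in> A then g v else 0)) = (\<lambda>v. if v \<in> A then g v else 0)"
      by (rule lookup_Abs_poly_mapping)
    show "\<exists>e\<in>exponent_box A D. g = restrict (Poly_Mapping.lookup e) A"
    proof (rule bexI)
      show "g = restrict (Poly_Mapping.lookup (Abs_poly_mapping (\<lambda>v. if v \<in> A then g v else 0))) A"
        unfolding l
      proof
        fix v show "g v = restrict (\<lambda>v. if v \<in> A then g v else 0) A v"
          using PiE_arb[OF g, of v] by simp
      qed
      show "Abs_poly_mapping (\<lambda>v. if v \<in> A then g v else 0) \<in> exponent_box A D"
        unfolding exponent_box_def mem_Collect_eq l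
      proof (intro conjI allI subsetI)
        show "(if v \<in> A then g v else 0) < D" for v
          using PiE_mem[OF g, of v] D by simp
        show "v \<in> A" if "v \<in> Poly_Mapping.keys (Abs_poly_mapping (\<lambda>v. if v \<in> A then g v else 0))" for v
          using that unfolding in_keys_iff l by (simp split: if_splits)
      qed
    qed
  qed
  from bij_betw_finite[OF this] bij_betw_same_card[OF this] show ?thesis
    using A by (simp add: card_PiE finite_PiE)
qed

text \<open>Each exponent is bounded separately, to match the box; such bounds add up under
  multiplication.\<close>

definition exponents_le :: "nat \<Rightarrow> 'k::comm_ring_1 mpoly \<Rightarrow> bool" where
  "exponents_le c f \<longleftrightarrow> (\<forall>e\<in>Poly_Mapping.keys f. \<forall>v. Poly_Mapping.lookup e v \<le> c)"

lemma exponents_le_mult: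
  assumes "exponents_le c f" "exponents_le d g"
  shows "exponents_le (c + d) (f * g)"
  unfolding exponents_le_def
proof (intro ballI allI)
  fix e v assume "e \<in> Poly_Mapping.keys (f * g)"
  then obtain a b where "e = a + b" "a \<in> Poly_Mapping.keys f" "b \<in> Poly_Mapping.keys g"
    using keys_mult[of f g] by blast
  with assms show "Poly_Mapping.lookup e v \<le> c + d"
    by (auto simp: exponents_le_def lookup_add intro: add_mono)
qed

lemma exponents_le_one [simp]: "exponents_le 0 1"
  by (auto simp: exponents_le_def)

lemma exponents_le_power: "exponents_le c f \<Longrightarrow> exponents_le (n * c) (f ^ n)"
  by (induction n) (auto dest: exponents_le_mult)

lemma exponents_le_prod:
  "finite A \<Longrightarrow> (\<And>a. a \<in> A \<Longrightarrow> exponents_le (c a) (f a)) \<Longrightarrow> exponents_le (\<Sum>a\<in>A. c a) (\<Prod>a\<in>A. f a)"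
  by (induction rule: finite_induct) (auto dest: exponents_le_mult)

lemma exponents_le_mono: "exponents_le c f \<Longrightarrow> c \<le> d \<Longrightarrow> exponents_le d f"
  unfolding exponents_le_def using le_trans by blast

lemma exponents_le_exists: "\<exists>c. exponents_le c f"
proof -
  have "Poly_Mapping.lookup e v \<le> (\<Sum>e\<in>Poly_Mapping.keys f. \<Sum>v\<in>Poly_Mapping.keys e. Poly_Mapping.lookup e v)"
    if "e \<in> Poly_Mapping.keys f" for e v
  proof (cases "v \<in> Poly_Mapping.keys e")
    case True
    then have "Poly_Mapping.lookup e v \<le> (\<Sum>v\<in>Poly_Mapping.keys e. Poly_Mapping.lookup e v)"
      by (intro member_le_sum) auto
    also have "\<dots> \<le> (\<Sum>e\<in>Poly_Mapping.keys f. \<Sum>v\<in>Poly_Mapping.keys e. Poly_Mapping.lookup e v)"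
      using that by (intro member_le_sum[where f = "\<lambda>e. \<Sum>v\<in>Poly_Mapping.keys e. Poly_Mapping.lookup e v"]) auto
    finally show ?thesis .
  qed (simp add: in_keys_iff)
  then show ?thesis unfolding exponents_le_def by blast
qed

definition mpoly_scale :: "'k::field \<Rightarrow> 'k mpoly \<Rightarrow> 'k mpoly" where
  "mpoly_scale c f = Poly_Mapping.single 0 c * f"

interpretation mpoly_vs: vector_space "mpoly_scale :: 'k::field \<Rightarrow> 'k mpoly \<Rightarrow> 'k mpoly"
proof
  fix a b :: 'k and x y :: "'k mpoly"
  show "mpoly_scale a (mpoly_scale b x) = mpoly_scale (a * b) x"
    by (simp add: mpoly_scale_def mult_single flip: mult.assoc)
qed (simp_all add: mpoly_scale_def distrib_left distrib_right single_add)

text \<open>The \<open>D\<^sup>m\<close> monomials with exponents below \<open>D\<close> are sent into the span of only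
  \<open>(m c D + 1)\<^sup>N\<close> monomials, where \<open>N = card V\<close>; for \<open>m > N\<close> and large \<open>D\<close> this forces a relation.\<close>

lemma algebraically_dependent:
  fixes t :: "nat \<Rightarrow> 'k::field mpoly"
  assumes V: "finite V" "card V < m" and t: "\<And>i. i < m \<Longrightarrow> indets (t i) \<subseteq> V"
  obtains g where "g \<noteq> 0" "indets g \<subseteq> {..<m}" "poly_subst t g = 0"
proof (rule ccontr)
  assume "\<not> thesis"
  then have inj: "g = 0" if "indets g \<subseteq> {..<m}" "poly_subst t g = 0" for g
    using that by (meson \<open>\<And>g. _ \<Longrightarrow> _ \<Longrightarrow> _ \<Longrightarrow> thesis\<close>)
  obtain c0 where c0: "\<And>i. exponents_le (c0 i) (t i)"
    using choice[of "\<lambda>i c. exponents_le c (t i)"] exponents_le_exists by blast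
  define c where "c = (\<Sum>i<m. c0 i)"
  have c: "exponents_le c (t i)" if "i < m" for i
    using that unfolding c_def by (intro exponents_le_mono[OF c0] member_le_sum) auto
  define N where "N = card V"
  \<comment> \<open>\<open>D\<close> exceeds \<open>(m * c + 1) ^ N\<close>, so the estimate
    \<open>((m * c + 1) * D) ^ N\<close> stays below \<open>D ^ Suc N\<close>, which is at most
    \<open>D ^ m\<close>.\<close>
  define D where "D = (m * c + 1) ^ N + 1"
  define b where "b e = poly_subst t (Poly_Mapping.single e 1)" for e
  define S where "S = exponent_box {..<m} D"
  define T where "T = (\<lambda>e. Poly_Mapping.single e 1 :: 'k mpoly) ` exponent_box V (m * c * D + 1)"
  have D: "0 < D" by (simp add: D_def)
  have S: "finite S" "card S = D ^ m"
    using finite_card_exponent_box[of "{..<m}" D] D by (auto simp: S_def)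
  have T: "finite T" "card T \<le> (m * c * D + 1) ^ N"
    using finite_card_exponent_box[of V "m * c * D + 1"] V card_image_le[of "exponent_box V (m * c * D + 1)"]
    by (auto simp: T_def N_def)
  have indets_S: "indets (Poly_Mapping.single e a) \<subseteq> {..<m}" if "e \<in> S" for e and a :: 'k
    using indets_single[of e a] that by (auto simp: S_def exponent_box_def)
  have b_inj: "inj_on b S"
  proof
    fix e e' assume e: "e \<in> S" "e' \<in> S" "b e = b e'"
    have "Poly_Mapping.single e (1::'k) - Poly_Mapping.single e' 1 = 0"
    proof (rule inj)
      show "indets (Poly_Mapping.single e (1::'k) - Poly_Mapping.single e' 1) \<subseteq> {..<m}"
        using e by (intro indets_diff_subset indets_S)
      show "poly_subst t (Poly_Mapping.single e 1 - Poly_Mapping.single e' 1) = 0"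
        using e(3) unfolding b_def poly_subst_diff by simp
    qed
    then show "e = e'"
      by (metis eq_iff_diff_eq_0 lookup_single_eq lookup_single_not_eq zero_neq_one)
  qed
  have "b ` S \<subseteq> mpoly_vs.span T"
  proof
    fix f assume "f \<in> b ` S"
    then obtain e where e: "e \<in> S" "f = b e" by blast
    have keys: "Poly_Mapping.keys e \<subseteq> {..<m}" and less: "Poly_Mapping.lookup e v < D" for v
      using e by (auto simp: S_def exponent_box_def)
    have f: "f = monom_eval t e" by (simp add: e b_def poly_subst_single)
    have "exponents_le (\<Sum>v\<in>Poly_Mapping.keys e. Poly_Mapping.lookup e v * c) f"
      unfolding f monom_eval_def using keys by (intro exponents_le_prod exponents_le_power c) auto
    moreover have "(\<Sum>v\<in>Poly_Mapping.keys e. Poly_Mapping.lookup e v * c) \<le> (\<Sum>v\<in>{..<m}. D * c)"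
      using keys less by (intro sum_le_included[where i = id]) (auto intro!: mult_right_mono less_imp_le)
    ultimately have "exponents_le (m * c * D) f"
      by (auto intro: exponents_le_mono simp: mult_ac)
    moreover have "indets f \<subseteq> V"
      unfolding f using keys t by (intro indets_monom_eval_subset) auto
    ultimately have box: "k \<in> exponent_box V (m * c * D + 1)" if "k \<in> Poly_Mapping.keys f" for k
      using that by (auto simp: exponent_box_def exponents_le_def indets_def less_Suc_eq_le)
    have "f = (\<Sum>k\<in>Poly_Mapping.keys f. mpoly_scale (Poly_Mapping.lookup f k) (Poly_Mapping.single k 1))"
      by (subst mpoly_expansion[of f]) (simp add: mpoly_scale_def mult_single)
    also have "\<dots> \<in> mpoly_vs.span T"
      using box by (intro mpoly_vs.span_sum mpoly_vs.span_scale mpoly_vs.span_base) (auto simp: T_def)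
    finally show "f \<in> mpoly_vs.span T" .
  qed
  \<comment> \<open>A linear relation among the images of monomials is a polynomial relation among
    the \<open>t i\<close>.\<close>
  moreover have "mpoly_vs.independent (b ` S)"
  proof
    assume "mpoly_vs.dependent (b ` S)"
    then obtain u where u: "\<exists>v\<in>b ` S. u v \<noteq> 0" "(\<Sum>v\<in>b ` S. mpoly_scale (u v) v) = 0"
      using S(1) by (auto simp: mpoly_vs.dependent_finite)
    define g where "g = (\<Sum>e\<in>S. Poly_Mapping.single e (u (b e)))"
    have "poly_subst t (Poly_Mapping.single e a) = mpoly_scale a (b e)" for e a
      by (simp add: b_def mpoly_scale_def poly_subst_single)
    then have "poly_subst t g = (\<Sum>e\<in>S. mpoly_scale (u (b e)) (b e))"
      by (simp add: g_def poly_subst_sum)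
    also have "\<dots> = 0"
      using u(2) by (simp add: sum.reindex[OF b_inj])
    finally have "poly_subst t g = 0" .
    moreover have "indets g \<subseteq> {..<m}"
      unfolding g_def by (intro indets_sum_subset indets_S)
    ultimately have "g = 0" by (rule inj[rotated])
    have "u (b e) = 0" if "e \<in> S" for e
    proof -
      have "Poly_Mapping.lookup g e = (\<Sum>e'\<in>S. if e' = e then u (b e') else 0)"
        unfolding g_def lookup_sum by (intro sum.cong) (auto simp: lookup_single when_def)
      then show ?thesis using that S(1) \<open>g = 0\<close> by simp
    qed
    with u(1) show False by blast
  qed
  ultimately have "card (b ` S) \<le> card T"
    using mpoly_vs.independent_span_bound[OF T(1)] by blast
  then have "D ^ m \<le> (m * c * D + 1) ^ N"
    using T(2) S(2) by (simp add: card_image[OF b_inj])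
  also have "\<dots> \<le> ((m * c + 1) * D) ^ N"
    using D by (intro power_mono) (simp_all add: algebra_simps)
  also have "\<dots> < D * D ^ N"
    unfolding power_mult_distrib using D by (intro mult_strict_right_mono) (simp_all add: D_def)
  also have "D * D ^ N = D ^ Suc N" by simp
  also have "\<dots> \<le> D ^ m"
    using D V(2) by (intro power_increasing) (auto simp: N_def)
  finally show False by simp
qed

section \<open>Algebraic independence of residue classes\<close>

definition independent_mod :: "nat set \<Rightarrow> 'k::comm_ring_1 mpoly set \<Rightarrow> nat \<Rightarrow> (nat \<Rightarrow> 'k mpoly) \<Rightarrow> bool" where
  "independent_mod V P d t \<longleftrightarrow> (\<forall>i<d. indets (t i) \<subseteq> V) \<and>
     (\<forall>g. indets g \<subseteq> {..<d} \<longrightarrow> poly_subst t g \<in> P \<longrightarrow> g = 0)"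

text \<open>\<open>g0\<close> collects the monomials free of \<open>d\<close>. The last clause lets
  an induction run on a strict bound for the exponent of \<open>d\<close>; in particular
  \<open>g1 = 0\<close> if \<open>d\<close> does not occur.\<close>

lemma split_off_variable:
  fixes g :: "'k::comm_ring_1 mpoly"
  obtains g0 g1 where "g = g0 + Var d * g1" "indets g0 \<subseteq> indets g - {d}" "indets g1 \<subseteq> indets g"
    and "\<forall>n. (\<forall>e\<in>Poly_Mapping.keys g. Poly_Mapping.lookup e d \<le> n) \<longrightarrow>
      (\<forall>e\<in>Poly_Mapping.keys g1. Poly_Mapping.lookup e d < n)"
proof -
  define A where "A = {e \<in> Poly_Mapping.keys g. Poly_Mapping.lookup e d = 0}"
  define B where "B = {e \<in> Poly_Mapping.keys g. 0 < Poly_Mapping.lookup e d}"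
  define x :: "nat \<Rightarrow>\<^sub>0 nat" where "x = Poly_Mapping.single d (Suc 0)"
  define g0 where "g0 = (\<Sum>e\<in>A. Poly_Mapping.single e (Poly_Mapping.lookup g e))"
  define g1 where "g1 = (\<Sum>e\<in>B. Poly_Mapping.single (e - x) (Poly_Mapping.lookup g e))"
  have x: "x + (e - x) = e" if "e \<in> B" for e
    using that by (intro poly_mapping_eqI)
      (auto simp: x_def B_def lookup_add lookup_minus lookup_single when_def)
  have keys_x: "Poly_Mapping.keys (e - x) \<subseteq> Poly_Mapping.keys e" for e
    by (auto simp: in_keys_iff lookup_minus)
  have "Poly_Mapping.keys g = A \<union> B" "A \<inter> B = {}" "finite A" "finite B"
    by (auto simp: A_def B_def)
  then have "g = (\<Sum>e\<in>A. Poly_Mapping.single e (Poly_Mapping.lookup g e)) + (\<Sum>e\<in>B. Poly_Mapping.single e (Poly_Mapping.lookup g e))"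
    by (subst mpoly_expansion[of g]) (simp add: sum.union_disjoint)
  also have "(\<Sum>e\<in>B. Poly_Mapping.single e (Poly_Mapping.lookup g e)) = Var d * g1"
    unfolding g1_def sum_distrib_left
    by (intro sum.cong refl) (simp add: Var_def mult_single x x_def[symmetric])
  finally have 1: "g = g0 + Var d * g1" by (simp add: g0_def)
  have 2: "indets g0 \<subseteq> indets g - {d}"
  proof -
    have "indets (Poly_Mapping.single e (Poly_Mapping.lookup g e)) \<subseteq> indets g - {d}" if "e \<in> A" for e
    proof -
      have "d \<notin> Poly_Mapping.keys e" "Poly_Mapping.keys e \<subseteq> indets g"
        using that by (auto simp: A_def in_keys_iff[of d] indets_def)
      then show ?thesis using indets_single[of e "Poly_Mapping.lookup g e"] by blast
    qed
    then show ?thesis unfolding g0_def by (intro indets_sum_subset)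
  qed
  have 3: "indets g1 \<subseteq> indets g"
  proof -
    have "indets (Poly_Mapping.single (e - x) (Poly_Mapping.lookup g e)) \<subseteq> indets g" if "e \<in> B" for e
    proof -
      have "Poly_Mapping.keys e \<subseteq> indets g"
        using that by (auto simp: B_def indets_def)
      then show ?thesis
        using indets_single[of "e - x" "Poly_Mapping.lookup g e"] keys_x[of e] by blast
    qed
    then show ?thesis unfolding g1_def by (intro indets_sum_subset)
  qed
  have "Poly_Mapping.keys g1 \<subseteq> (\<lambda>e. e - x) ` B"
    unfolding g1_def by (rule order_trans[OF keys_sum]) auto
  moreover have "Poly_Mapping.lookup (e - x) d < n"
    if "\<forall>e\<in>Poly_Mapping.keys g. Poly_Mapping.lookup e d \<le> n" "e \<in> B" for n e
  proof -
    have "0 < Poly_Mapping.lookup e d" "Poly_Mapping.lookup e d \<le> n"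
      using that by (auto simp: B_def)
    then show ?thesis by (simp add: lookup_minus x_def)
  qed
  ultimately have 4: "\<forall>n. (\<forall>e\<in>Poly_Mapping.keys g. Poly_Mapping.lookup e d \<le> n) \<longrightarrow>
      (\<forall>e\<in>Poly_Mapping.keys g1. Poly_Mapping.lookup e d < n)"
    by blast
  show thesis by (rule that[OF 1 2 3 4])
qed

text \<open>Modulo \<open>Q\<close> the element \<open>f\<close> vanishes, so a relation modulo
  \<open>P\<close> leaves a relation \<open>g0\<close> among the old elements, which must be 0. Then
  \<open>f\<close> can be cancelled modulo the prime \<open>P\<close>, and a relation
  \<open>g1\<close> of lower degree in the new variable remains.\<close>

lemma independent_mod_Suc:
  fixes t :: "nat \<Rightarrow> 'k::comm_ring_1 mpoly"
  assumes P: "primeideal P (mpoly_ring V)" and Q: "ideal Q (mpoly_ring V)" "P \<subseteq> Q"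
    and f: "f \<in> Q" "f \<notin> P" and t: "independent_mod V Q d t"
  shows "independent_mod V P (Suc d) (t(d := f))"
proof -
  define s where "s = t(d := f)"
  note P' = primeideal_mpoly_ringD[OF P]
  have fV: "indets f \<subseteq> V" using ideal_mpoly_ringD(1)[OF Q(1)] f by auto
  have s: "indets (s i) \<subseteq> V" if "i < Suc d" for i
    using that t fV by (auto simp: s_def independent_mod_def)
  have sub: "indets (poly_subst s g) \<subseteq> V" if "indets g \<subseteq> {..<Suc d}" for g
    using that s by (intro indets_poly_subst_subset) auto
  have "g = 0"
    if "indets g \<subseteq> {..<Suc d}" "poly_subst s g \<in> P" "\<And>e. e \<in> Poly_Mapping.keys g \<Longrightarrow> Poly_Mapping.lookup e d < n" for g n
    using that
  proof (induction n arbitrary: g)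
    case 0
    then have "Poly_Mapping.keys g = {}" by blast
    then show ?case by simp
  next
    case (Suc n)
    obtain g0 g1 where g: "g = g0 + Var d * g1" "indets g0 \<subseteq> indets g - {d}" "indets g1 \<subseteq> indets g"
      and less: "\<forall>n. (\<forall>e\<in>Poly_Mapping.keys g. Poly_Mapping.lookup e d \<le> n) \<longrightarrow>
        (\<forall>e\<in>Poly_Mapping.keys g1. Poly_Mapping.lookup e d < n)"
      by (rule split_off_variable[of g d])
    have "indets g0 \<subseteq> {..<Suc d} - {d}" and g1: "indets g1 \<subseteq> {..<Suc d}"
      using g(2,3) Suc.prems(1) by blast+
    then have g0: "indets g0 \<subseteq> {..<d}" by auto
    have eq: "poly_subst s g = poly_subst s g0 + f * poly_subst s g1"
      by (simp add: g(1) poly_subst_add poly_subst_mult) (simp add: s_def)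
    have "poly_subst s g0 = poly_subst s g - poly_subst s g1 * f"
      using eq by (simp add: mult.commute)
    also have "\<dots> \<in> Q"
      using Suc.prems(2) Q(2) f(1) sub[OF g1]
      by (intro ideal_mpoly_ringD(4,5)[OF Q(1)]) auto
    also have "poly_subst s g0 = poly_subst t g0"
      by (rule poly_subst_cong) (use g0 in \<open>auto simp: s_def\<close>)
    finally have "g0 = 0" using t g0 by (auto simp: independent_mod_def)
    with eq Suc.prems(2) have "f * poly_subst s g1 \<in> P" by simp
    with P'(3)[OF fV sub[OF g1]] f(2) have "poly_subst s g1 \<in> P" by blast
    then have "g1 = 0"
      using Suc.IH[OF g1] less Suc.prems(3) by (simp add: less_Suc_eq_le)
    with g(1) \<open>g0 = 0\<close> show ?case by simp
  qed
  moreover have "\<exists>n. \<forall>e\<in>Poly_Mapping.keys g. Poly_Mapping.lookup e d < n" for g :: "'k mpoly"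
    using exponents_le_exists[of g] unfolding exponents_le_def by (meson le_imp_less_Suc)
  ultimately have "g = 0" if "indets g \<subseteq> {..<Suc d}" "poly_subst s g \<in> P" for g
    using that by metis
  with s show ?thesis by (auto simp: independent_mod_def s_def)
qed

text \<open>Without indeterminates only constants remain, and a nonzero constant of a field is a
  unit, hence outside \<open>P\<close>.\<close>

lemma independent_mod_0:
  fixes P :: "'k::field mpoly set"
  assumes P: "primeideal P (mpoly_ring V)"
  shows "independent_mod V P 0 t"
  unfolding independent_mod_def
proof (intro conjI allI impI)
  fix g :: "'k mpoly" assume g: "indets g \<subseteq> {..<0}" "poly_subst t g \<in> P"
  have "Poly_Mapping.keys g \<subseteq> {0}"
    using g(1) by (auto simp: indets_def)
  then have g_eq: "g = Poly_Mapping.single 0 (Poly_Mapping.lookup g 0)"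
    by (subst mpoly_expansion[of g], subst sum.mono_neutral_left[of "{0}"]) (auto simp: in_keys_iff)
  show "g = 0"
  proof (rule ccontr)
    assume "g \<noteq> 0"
    then have "Poly_Mapping.lookup g 0 \<noteq> 0" using g_eq by auto
    moreover have "Poly_Mapping.single 0 (Poly_Mapping.lookup g 0) \<in> P"
      using g(2) by (subst (asm) g_eq) simp
    then have "Poly_Mapping.single 0 (inverse (Poly_Mapping.lookup g 0)) * Poly_Mapping.single 0 (Poly_Mapping.lookup g 0) \<in> P"
      by (rule ideal_mpoly_ringD(4)[OF primeideal_mpoly_ringD(1)[OF P]]) simp
    ultimately show False
      using primeideal_mpoly_ringD(2)[OF P] by (simp add: mult_single)
  qed
qed simp

section \<open>Lengths of chains and height\<close>

definition prime_chain :: "('a, 'b) ring_scheme \<Rightarrow> nat \<Rightarrow> (nat \<Rightarrow> 'a set) \<Rightarrow> bool" where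
  "prime_chain R n C \<longleftrightarrow> (\<forall>i\<le>n. primeideal (C i) R) \<and> (\<forall>i<n. C i \<subset> C (Suc i))"

text \<open>Descending from the top, each strict inclusion contributes one more independent element.
  At the bottom there are \<open>n\<close> elements independent modulo \<open>C 0\<close>, hence
  over the field, since \<open>C 0\<close> contains 0.\<close>

lemma prime_chain_mpoly_length:
  fixes C :: "nat \<Rightarrow> 'k::field mpoly set"
  assumes V: "finite V" and C: "prime_chain (mpoly_ring V) n C"
  shows "n \<le> card V"
proof (rule ccontr)
  assume n: "\<not> n \<le> card V"
  have "\<exists>t. independent_mod V (C (n - d)) d t" if "d \<le> n" for d
    using that
  proof (induction d)
    case 0
    then show ?case using C independent_mod_0[of "C n" V] by (auto simp: prime_chain_def)
  next
    case (Suc d)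
    then obtain t where t: "independent_mod V (C (n - d)) d t" by auto
    have "C (n - Suc d) \<subset> C (n - d)"
      using C Suc.prems by (simp add: prime_chain_def Suc_diff_Suc[symmetric])
    then obtain f where "f \<in> C (n - d)" "f \<notin> C (n - Suc d)" "C (n - Suc d) \<subseteq> C (n - d)" by blast
    moreover have "primeideal (C (n - Suc d)) (mpoly_ring V)" "ideal (C (n - d)) (mpoly_ring V)"
      using C by (auto simp: prime_chain_def intro: primeideal_mpoly_ringD(1))
    ultimately show ?case
      using independent_mod_Suc t by blast
  qed
  from this[of n] obtain t where t: "independent_mod V (C 0) n t" by auto
  obtain g where "g \<noteq> 0" "indets g \<subseteq> {..<n}" "poly_subst t g = 0"
    using algebraically_dependent[of V n t] V n t by (auto simp: independent_mod_def)
  moreover have "0 \<in> C 0"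
    using C by (auto simp: prime_chain_def intro: ideal_mpoly_ringD(2) primeideal_mpoly_ringD(1))
  ultimately show False using t by (auto simp: independent_mod_def)
qed

lemma prime_height_eqI:
  assumes "prime_chain R n C" "C n = P"
    and "\<And>m C. prime_chain R m C \<Longrightarrow> C m = P \<Longrightarrow> m \<le> n"
  shows "prime_height R P = enat n"
proof -
  have eq: "prime_height R P = Sup {enat m | m. \<exists>C. prime_chain R m C \<and> C m = P}"
    by (simp add: prime_height_def prime_chain_def conj_assoc)
  show ?thesis
    unfolding eq
  proof (rule antisym)
    show "Sup {enat m | m. \<exists>C. prime_chain R m C \<and> C m = P} \<le> enat n"
      using assms(3) by (intro Sup_least) auto
    show "enat n \<le> Sup {enat m | m. \<exists>C. prime_chain R m C \<and> C m = P}"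
      using assms(1,2) by (intro Sup_upper) auto
  qed
qed

text \<open>Replacing the last member of a chain by the larger prime keeps its length.\<close>

lemma prime_height_mono:
  assumes P: "primeideal P R" "I \<subseteq> P"
  shows "prime_height R I \<le> prime_height R P"
  unfolding prime_height_def
proof (rule Sup_subset_mono, rule subsetI)
  fix x assume "x \<in> {enat n |n. \<exists>C. (\<forall>i\<le>n. primeideal (C i) R) \<and> (\<forall>i<n. C i \<subset> C (Suc i)) \<and> C n = I}"
  then obtain n C where x: "x = enat n" and C: "\<forall>i\<le>n. primeideal (C i) R" "\<forall>i<n. C i \<subset> C (Suc i)" "C n = I"
    by blast
  have "\<forall>i\<le>n. primeideal ((C(n := P)) i) R" using C P by auto
  moreover have "\<forall>i<n. (C(n := P)) i \<subset> (C(n := P)) (Suc i)"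
  proof (intro allI impI)
    fix i assume i: "i < n"
    then have "C i \<subset> C (Suc i)" using C(2) by blast
    moreover from this have "C i \<subset> P" if "Suc i = n"
      using that C(3) P(2) by (auto intro: psubset_subset_trans)
    ultimately show "(C(n := P)) i \<subset> (C(n := P)) (Suc i)"
      using i by (simp del: psubset_eq add: fun_upd_def)
  qed
  moreover have "(C(n := P)) n = P" by simp
  ultimately show "x \<in> {enat n |n. \<exists>C. (\<forall>i\<le>n. primeideal (C i) R) \<and> (\<forall>i<n. C i \<subset> C (Suc i)) \<and> C n = P}"
    using x by blast
qed

lemma height_primeideal:
  assumes "primeideal I R"
  shows "height R I = prime_height R I"
  unfolding height_def
  by (intro antisym INF_lower INF_greatest prime_height_mono) (use assms in auto)

section \<open>Chains of kernels below and above the scroll ideal\<close>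

lemma subst_kernel_subset:
  assumes "\<And>v. v \<in> V \<Longrightarrow> poly_subst \<tau> (s v) = t v"
  shows "subst_kernel V s \<subseteq> subst_kernel V t"
proof
  fix f assume f: "f \<in> subst_kernel V s"
  \<comment> \<open>On \<open>V\<close> the substitution \<open>t\<close> is a specialization of
    \<open>s\<close>, so it kills whatever \<open>s\<close> kills.\<close>
  then have "poly_subst t f = poly_subst \<tau> (poly_subst s f)"
    unfolding poly_subst_poly_subst using assms by (intro poly_subst_cong) (auto simp: subst_kernel_def)
  with f show "f \<in> subst_kernel V t" by (simp add: subst_kernel_def)
qed

lemma subst_kernel_psubset:
  assumes "\<And>v. v \<in> V \<Longrightarrow> poly_subst \<tau> (s v) = t v"
    and "indets f \<subseteq> V" "poly_subst t f = 0" "poly_subst s f \<noteq> 0"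
  shows "subst_kernel V s \<subset> subst_kernel V t"
  using subst_kernel_subset[of V \<tau> s t] assms by (auto simp: subst_kernel_def)

lemma Var_neq_zero [simp]: "Var v \<noteq> (0 :: 'k::comm_ring_1 mpoly)"
  by (metis Var_def lookup_single_eq lookup_zero zero_neq_one)

text \<open>The chain below the scroll ideal parametrizes one indeterminate after the other. The step at
  \<open>y\<^sub>0\<close> imposes no condition and is skipped.\<close>

definition partial_param :: "nat \<Rightarrow> nat \<Rightarrow> nat \<Rightarrow> 'k::comm_ring_1 mpoly" where
  "partial_param q c v = (if v \<le> c then scroll_param q v else Var v)"

text \<open>The indeterminate \<open>Suc c\<close> is not a parameter of the entries already
  replaced: \<open>0\<close> and \<open>1\<close> are at most \<open>c\<close>, and at
  \<open>Suc c = q + 1\<close> the parameter is substituted by itself.\<close>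

lemma partial_param_step:
  assumes "0 < c"
  shows "poly_subst (Var(Suc c := scroll_param q (Suc c))) (partial_param q c v) =
    (partial_param q (Suc c) v :: 'k::comm_ring_1 mpoly)"
  using assms by (auto simp: partial_param_def scroll_param_def poly_subst_mult poly_subst_power var_index_def le_Suc_eq)

lemma partial_param_kernel_mono:
  "0 < c \<Longrightarrow> subst_kernel V (partial_param q c) \<subseteq> (subst_kernel V (partial_param q (Suc c)) :: 'k::comm_ring_1 mpoly set)"
  by (rule subst_kernel_subset[OF partial_param_step])

lemma partial_param_kernel_strict:
  assumes c: "0 < c" "c \<noteq> q" "Suc c < 2 * q + 2"
  shows "subst_kernel {..<2 * q + 2} (partial_param q c) \<subset>
    (subst_kernel {..<2 * q + 2} (partial_param q (Suc c)) :: 'k::idom mpoly set)"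
proof (rule subst_kernel_psubset[OF partial_param_step[OF c(1)]])
  \<comment> \<open>The minor of the first column and the column headed by \<open>c\<close>. There
    is no such column for \<open>c = q\<close>, because \<open>y_0\<close> is not tied to
    \<open>x_q\<close>.\<close>
  let ?f = "Var 0 * Var (Suc c) - Var 1 * Var c :: 'k mpoly"
  show "indets ?f \<subseteq> {..<2 * q + 2}" using c by (intro indets_diff_subset indets_mult_subset) auto
  have q: "0 < q" using c by auto
  have "scroll_param q (Suc c) = (scroll_param q c * Var 1 :: 'k mpoly)"
  proof (cases "c < q")
    case True
    then show ?thesis by (simp add: scroll_param_def var_index_def mult_ac)
  next
    case False
    then have "c - q = Suc (c - Suc q)" using c(2) by simp
    with False c(2) show ?thesis by (simp add: scroll_param_def var_index_def mult_ac)
  qed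
  then show "poly_subst (partial_param q (Suc c)) ?f = 0"
    using c q by (simp add: poly_subst_diff poly_subst_mult partial_param_def)
      (simp add: scroll_param_def var_index_def mult_ac)
  show "poly_subst (partial_param q c) ?f \<noteq> 0"
  proof
    assume 0: "poly_subst (partial_param q c) ?f = 0"
    \<comment> \<open>The indeterminate \<open>Suc c\<close> is still free at this stage; setting it
      to 0 leaves a single nonzero product.\<close>
    have "poly_subst (Var(Suc c := 0)) (poly_subst (partial_param q c) ?f) = - (Var 0 * Var 1 * scroll_param q c)"
      using c q by (simp add: poly_subst_diff poly_subst_mult partial_param_def)
        (auto simp add: scroll_param_def var_index_def poly_subst_mult poly_subst_power)
    then show False unfolding 0 by (auto simp: scroll_param_def)
  qed
qed

lemma scroll_chain_below:
  assumes q: "0 < q"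
  obtains C where "prime_chain (mpoly_ring {..<2 * q + 2}) (2 * q - 1) C"
    "C (2 * q - 1) = (scroll_ideal q :: 'k::idom mpoly set)"
proof
  define K where "K c = (subst_kernel {..<2 * q + 2} (partial_param q c) :: 'k mpoly set)" for c
  \<comment> \<open>The indices run from \<open>1\<close> to \<open>2 * q + 1\<close> without
    \<open>q + 1\<close>, which gives \<open>2 * q\<close> members and \<open>2 * q - 1\<close>
    steps.\<close>
  define C where "C i = K (if i < q then i + 1 else i + 2)" for i
  have "C i \<subset> C (Suc i)" if "i < 2 * q - 1" for i
  proof -
    consider "Suc i < q" | "Suc i = q" | "q < Suc i" by linarith
    then show ?thesis
    proof cases
      case 1
      then show ?thesis using partial_param_kernel_strict[of "i + 1" q] by (simp add: C_def K_def)
    next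
      case 2
      have "K q \<subseteq> K (Suc q)" "K (Suc q) \<subset> K (Suc (Suc q))"
        using q partial_param_kernel_mono[of q] partial_param_kernel_strict[of "Suc q" q] by (simp_all add: K_def)
      with 2 show ?thesis by (auto simp: C_def)
    next
      case 3
      moreover have "Suc i < 2 * q" using that by linarith
      ultimately show ?thesis using partial_param_kernel_strict[of "i + 2" q] by (simp add: C_def K_def)
    qed
  qed
  then show "prime_chain (mpoly_ring {..<2 * q + 2}) (2 * q - 1) C"
    by (auto simp: prime_chain_def C_def K_def primeideal_subst_kernel)
  have "K (2 * q + 1) = subst_kernel {..<2 * q + 2} (scroll_param q)"
    unfolding K_def subst_kernel_def
    by (intro Collect_cong conj_cong refl arg_cong2[of _ _ _ _ "(=)"] poly_subst_cong) (auto simp: partial_param_def)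
  moreover have "\<not> 2 * q - 1 < q" "2 * q - 1 + 2 = 2 * q + 1"
    using q by linarith+
  ultimately show "C (2 * q - 1) = scroll_ideal q"
    using q by (simp only: C_def scroll_ideal_eq_kernel if_False)
qed

text \<open>The parameters \<open>a\<close>, \<open>s\<close>, \<open>b\<close> are set to 0 one
  after the other; the witnesses of strictness are \<open>x_0\<close>, \<open>y_1\<close> and
  \<open>y_0\<close>.\<close>

lemma scroll_chain_above:
  assumes q: "0 < q"
  obtains C where "prime_chain (mpoly_ring {..<2 * q + 2}) 3 C" "C 0 = (scroll_ideal q :: 'k::idom mpoly set)"
proof
  define s1 where "s1 v = poly_subst (Var(0 := 0)) (scroll_param q v :: 'k mpoly)" for v
  define s2 where "s2 v = poly_subst (Var(1 := 0)) (s1 v)" for v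
  let ?K = "subst_kernel {..<2 * q + 2}"
  define C :: "nat \<Rightarrow> 'k mpoly set" where
    "C = (!) [?K (scroll_param q), ?K s1, ?K s2, ?K (\<lambda>_. 0)]"
  have "?K (scroll_param q) \<subset> ?K s1"
    by (rule subst_kernel_psubset[of _ "Var(0 := 0)" _ _ "Var 0"])
       (auto simp: s1_def scroll_param_def var_index_def)
  moreover have "?K s1 \<subset> ?K s2"
    by (rule subst_kernel_psubset[of _ "Var(1 := 0)" _ _ "Var (q + 2)"])
       (use q in \<open>auto simp: s1_def s2_def scroll_param_def var_index_def poly_subst_mult poly_subst_power\<close>)
  moreover have "?K s2 \<subset> ?K (\<lambda>_. 0)"
  proof (rule subst_kernel_psubset[of _ "Var(q + 1 := 0)" _ _ "Var (q + 1)"])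
    show "poly_subst (Var(q + 1 := 0)) (s2 v) = 0" for v
      using q by (auto simp: s1_def s2_def scroll_param_def var_index_def poly_subst_mult poly_subst_power)
  qed (use q in \<open>auto simp: s1_def s2_def scroll_param_def var_index_def poly_subst_mult poly_subst_power\<close>)
  ultimately show "prime_chain (mpoly_ring {..<2 * q + 2}) 3 C"
    by (auto simp: prime_chain_def C_def le_Suc_eq less_Suc_eq numeral_3_eq_3 primeideal_subst_kernel)
  show "C 0 = scroll_ideal q"
    using q by (simp add: C_def scroll_ideal_eq_kernel)
qed

lemma prime_chain_append:
  assumes C: "prime_chain R m C" and D: "prime_chain R n D" and "C m = D 0"
  shows "prime_chain R (m + n) (\<lambda>i. if i \<le> m then C i else D (i - m))"
  unfolding prime_chain_def
proof (intro conjI allI impI)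
  fix i assume i: "i < m + n"
  consider "i < m" | "i = m" | "m < i" by linarith
  then show "(if i \<le> m then C i else D (i - m)) \<subset> (if Suc i \<le> m then C (Suc i) else D (Suc i - m))"
  proof cases
    case 2
    then have "D 0 \<subset> D (Suc 0)" using D i by (simp add: prime_chain_def)
    with 2 assms(3) show ?thesis by simp
  next
    case 3
    then have "D (i - m) \<subset> D (Suc (i - m))" using D i by (simp add: prime_chain_def)
    with 3 show ?thesis by (simp add: Suc_diff_le)
  qed (use C in \<open>auto simp: prime_chain_def\<close>)
qed (use C D in \<open>auto simp: prime_chain_def\<close>)

lemma height_scroll_ideal:
  assumes q: "0 < q"
  shows "height (scroll_ring q) (scroll_ideal q :: 'k::field mpoly set) = enat (2 * q - 1)"
proof -
  have "primeideal (scroll_ideal q :: 'k mpoly set) (scroll_ring q)"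
    using q by (simp add: scroll_ideal_eq_kernel scroll_ring_def primeideal_subst_kernel)
  then have "height (scroll_ring q) (scroll_ideal q :: 'k mpoly set) = prime_height (scroll_ring q) (scroll_ideal q :: 'k mpoly set)"
    by (rule height_primeideal)
  also have "\<dots> = enat (2 * q - 1)"
  proof -
    obtain C where C: "prime_chain (mpoly_ring {..<2 * q + 2}) (2 * q - 1) C" "C (2 * q - 1) = (scroll_ideal q :: 'k mpoly set)"
      using scroll_chain_below[OF q] by blast
    obtain D where D: "prime_chain (mpoly_ring {..<2 * q + 2}) 3 D" "D 0 = (scroll_ideal q :: 'k mpoly set)"
      using scroll_chain_above[OF q] by blast
    show ?thesis
    proof (rule prime_height_eqI[of _ _ C])
      fix m and C :: "nat \<Rightarrow> 'k mpoly set"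
      assume "prime_chain (scroll_ring q) m C" "C m = scroll_ideal q"
      \<comment> \<open>The three primes above turn the bound \<open>2 * q + 2\<close> on all chains
        into \<open>2 * q - 1\<close> for those ending here.\<close>
      then have "prime_chain (mpoly_ring {..<2 * q + 2}) (m + 3) (\<lambda>i. if i \<le> m then C i else D (i - m))"
        using D by (intro prime_chain_append) (auto simp: scroll_ring_def)
      then have "m + 3 \<le> card {..<2 * q + 2}"
        by (rule prime_chain_mpoly_length[rotated]) simp
      then show "m \<le> 2 * q - 1" by simp
    qed (use C in \<open>simp_all add: scroll_ring_def\<close>)
  qed
  finally show ?thesis .
qed

section \<open>Generation up to radical\<close>

lemma indets_of_nat [simp]: "indets (of_nat n :: 'k::comm_ring_1 mpoly) = {}"
  using indets_const[of "of_nat n :: 'k"] by simp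

lemma poly_subst_of_nat [simp]: "poly_subst t (of_nat n) = of_nat n"
  by (induction n) (simp_all add: poly_subst_add)

lemma indets_scroll_form:
  assumes "\<And>k. k \<le> i + 1 \<Longrightarrow> indets (z k :: 'k::comm_ring_1 mpoly) \<subseteq> V"
  shows "indets (scroll_form z i) \<subseteq> V"
  unfolding scroll_form_def
  by (intro indets_sum_subset indets_mult_subset indets_power_subset assms) auto

lemma poly_subst_scroll_form:
  "poly_subst t (scroll_form z i) = scroll_form (\<lambda>k. poly_subst t (z k)) i"
  by (simp add: scroll_form_def poly_subst_sum poly_subst_mult poly_subst_power poly_subst_uminus)

text \<open>On the curve all summands carry the same monomial
  \<open>a ^ Suc i * s ^ (Suc i * i)\<close>, so the alternating sum of binomial coefficients
  factors out.\<close>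

lemma scroll_form_curve:
  fixes a s :: "'k::comm_ring_1 mpoly"
  assumes "0 < i"
  shows "scroll_form (\<lambda>k. a * s ^ k) i = 0"
proof -
  have "scroll_form (\<lambda>k. a * s ^ k) i = (\<Sum>k\<le>i. (- 1) ^ k * of_nat (i choose k) * (a ^ Suc i * s ^ (Suc i * i)))"
    unfolding scroll_form_def atLeast0AtMost
  proof (intro sum.cong refl)
    fix k assume k: "k \<in> {..i}"
    have e: "Suc i * i = Suc i * (i - k) + k + i * k"
      using k by (simp add: distrib_left[symmetric] add.assoc flip: mult_Suc)
    have "a ^ Suc i = a ^ (i - k) * a * a ^ k"
      using k by (simp flip: power_Suc power_Suc2 power_add)
    then show "(- 1) ^ k * of_nat (i choose k) * (a * s ^ (i + 1)) ^ (i - k) * (a * s ^ k) * (a * s ^ i) ^ k =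
        (- 1) ^ k * of_nat (i choose k) * (a ^ Suc i * s ^ (Suc i * i))"
      unfolding e power_add power_mult power_mult_distrib
      by (simp add: power_mult_distrib mult_ac)
  qed
  also have "\<dots> = 0"
    using choose_alternating_sum[OF assms, where 'a = "'k mpoly"] by (simp flip: sum_distrib_right)
  finally show ?thesis .
qed

definition radical_generators :: "nat \<Rightarrow> 'k::comm_ring_1 mpoly set" where
  "radical_generators q =
     F_poly ` {1..q - 1} \<union> G_poly q ` {1..q - 1} \<union> {xvar 0 * yvar q q - xvar q * yvar q 0}"

lemma radical_generators_subset_scroll_ideal:
  assumes q: "0 < q"
  shows "radical_generators q \<subseteq> (scroll_ideal q :: 'k::idom mpoly set)"
proof -
  have x: "scroll_form xvar i \<in> (scroll_ideal q :: 'k mpoly set)" if i: "i \<in> {1..q - 1}" for i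
  proof -
    have "poly_subst (scroll_param q) (scroll_form xvar i :: 'k mpoly) = scroll_form (\<lambda>k. Var 0 * Var 1 ^ k) i"
      unfolding poly_subst_scroll_form unfolding scroll_form_def
      using i by (intro sum.cong refl) (auto simp: xvar_def scroll_param_def var_index_def)
    moreover have "indets (scroll_form xvar i :: 'k mpoly) \<subseteq> {..<2 * q + 2}"
      using i by (intro indets_scroll_form) (auto simp: xvar_def)
    ultimately show ?thesis
      using i by (simp add: scroll_ideal_eq_kernel[OF q] subst_kernel_def scroll_form_curve)
  qed
  have y: "scroll_form (yvar q) i \<in> (scroll_ideal q :: 'k mpoly set)" if i: "i \<in> {1..q - 1}" for i
  proof -
    have "poly_subst (scroll_param q) (scroll_form (yvar q) i :: 'k mpoly) = scroll_form (\<lambda>k. Var (q + 1) * Var 1 ^ k) i"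
      unfolding poly_subst_scroll_form unfolding scroll_form_def
      using i by (intro sum.cong refl) (auto simp: yvar_def scroll_param_def var_index_def)
    moreover have "indets (scroll_form (yvar q) i :: 'k mpoly) \<subseteq> {..<2 * q + 2}"
      using i by (intro indets_scroll_form) (auto simp: yvar_def)
    ultimately show ?thesis
      using i by (simp add: scroll_ideal_eq_kernel[OF q] subst_kernel_def scroll_form_curve)
  qed
  have "xvar 0 * yvar q q - xvar q * yvar q 0 \<in> (scroll_ideal q :: 'k mpoly set)"
  proof -
    have "indets (xvar 0 * yvar q q - xvar q * yvar q 0 :: 'k mpoly) \<subseteq> {..<2 * q + 2}"
      by (intro indets_diff_subset indets_mult_subset) (auto simp: xvar_def yvar_def)
    moreover have "poly_subst (scroll_param q) (xvar 0 * yvar q q - xvar q * yvar q 0 :: 'k mpoly) = 0"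
      by (simp add: poly_subst_diff poly_subst_mult xvar_def yvar_def scroll_param_def var_index_def)
    ultimately show ?thesis
      by (simp add: scroll_ideal_eq_kernel[OF q] subst_kernel_def)
  qed
  with x y show ?thesis
    unfolding radical_generators_def F_poly_def G_poly_def by blast
qed

lemma scroll_ideal_subset_prime:
  fixes Q :: "'k::comm_ring_1 mpoly set"
  assumes char: "prime CHAR('k)" "q = CHAR('k) ^ h" and q: "1 < q"
    and Q: "primeideal Q (mpoly_ring {..<2 * q + 2})" and gens: "radical_generators q \<subseteq> Q"
  shows "scroll_ideal q \<subseteq> Q"
proof -
  interpret cring "mpoly_ring {..<2 * q + 2} :: 'k mpoly ring" by (rule cring_mpoly_ring)
  interpret Q: prime_mpoly_ideal "{..<2 * q + 2}" Q by (rule prime_mpoly_ideal.intro[OF Q])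
  \<comment> \<open>The two sequences of indeterminates, treated uniformly so that all combinations
    of blocks are handled at once.\<close>
  define rows :: "(nat \<Rightarrow> 'k mpoly) set" where "rows = {xvar, yvar q}"
  have rows_indets: "indets (z i) \<subseteq> {..<2 * q + 2}" if "z \<in> rows" "i \<le> q" for z i
    using that by (auto simp: rows_def xvar_def yvar_def)
  have rows_form: "scroll_form z i \<in> Q" if "z \<in> rows" "1 \<le> i" "i < q" for z i
    using that gens by (auto simp: rows_def radical_generators_def F_poly_def G_poly_def)
  have xy: "xvar 0 * yvar q q - xvar q * yvar q 0 \<in> Q"
    using gens by (auto simp: radical_generators_def)
  have yx: "yvar q 0 * xvar q - yvar q q * xvar 0 \<in> Q"
    using Q.Q_diff[OF Q.Q_zero xy] by (simp add: mult.commute)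
  \<comment> \<open>For \<open>z = w\<close> the expression is 0; exchanging the two sequences
    changes the sign.\<close>
  have rows_corner: "z 0 * w q - z q * w 0 \<in> Q" if "z \<in> rows" "w \<in> rows" for z w
    using that xy yx by (auto simp: rows_def mult.commute)
  have minor: "z i * w (Suc j) - z (Suc i) * w j \<in> Q" if "z \<in> rows" "w \<in> rows" "i < q" "j < q" for z w i j
    using that by (intro Q.scroll_minor_in_prime[OF char q] rows_indets rows_form rows_corner)
  have column: "\<exists>z\<in>rows. \<exists>i<q. Var (column_var q a) = z i \<and> Var (Suc (column_var q a)) = z (Suc i)" if "a < 2 * q" for a
  proof (cases "a < q")
    case True
    then show ?thesis by (auto simp: rows_def column_var_def xvar_def)
  next
    case False
    then have "a - q < q" "Var (column_var q a) = yvar q (a - q)" "Var (Suc (column_var q a)) = yvar q (Suc (a - q))"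
      using that by (auto simp: column_var_def yvar_def)
    then show ?thesis unfolding rows_def by blast
  qed
  have "minors 2 (scroll_matrix q) \<subseteq> Q"
  proof
    fix f assume "f \<in> minors 2 (scroll_matrix q :: 'k mpoly mat)"
    then obtain a b where ab: "a < b" "b < 2 * q"
      "f = Var (column_var q a) * Var (Suc (column_var q b)) - Var (column_var q b) * Var (Suc (column_var q a))"
      unfolding scroll_minors by blast
    obtain z i where z: "z \<in> rows" "i < q" "Var (column_var q a) = z i" "Var (Suc (column_var q a)) = z (Suc i)"
      using column[of a] ab by auto
    obtain w j where w: "w \<in> rows" "j < q" "Var (column_var q b) = w j" "Var (Suc (column_var q b)) = w (Suc j)"
      using column[of b] ab by auto
    show "f \<in> Q"
      using minor[OF z(1) w(1) z(2) w(2)] by (simp add: ab(3) z w mult.commute)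
  qed
  then show ?thesis
    unfolding scroll_ideal_def scroll_ring_def by (intro genideal_minimal Q.is_ideal)
qed

theorem corollary2:
  fixes p h q :: nat
  assumes "prime p"
    and "CHAR('k::alg_closed_field) = p"
    and "h > 0"
    and "q = p ^ h"
  shows "(scroll_ideal q :: 'k mpoly set) =
           radical (scroll_ring q)
             (genideal (scroll_ring q)
               (F_poly ` {1..q - 1} \<union> G_poly q ` {1..q - 1} \<union> {xvar 0 * yvar q q - xvar q * yvar q 0}))
       \<and> set_theoretic_complete_intersection (scroll_ring q) (scroll_ideal q :: 'k mpoly set)"
proof -
  interpret cring "scroll_ring q :: 'k mpoly ring"
    unfolding scroll_ring_def by (rule cring_mpoly_ring)
  have q: "1 < q"
    using assms prime_gt_1_nat[of p] one_less_power[of p h] by simp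
  then have q0: "0 < q" by simp
  let ?J = "genideal (scroll_ring q) (radical_generators q :: 'k mpoly set)"
  have I: "primeideal (scroll_ideal q :: 'k mpoly set) (scroll_ring q)"
    unfolding scroll_ideal_eq_kernel[OF q0] scroll_ring_def by (rule primeideal_subst_kernel)
  have I_ideal: "ideal (scroll_ideal q :: 'k mpoly set) (scroll_ring q)"
    using I by (rule primeideal.axioms(1))
  have gens_carrier: "(radical_generators q :: 'k mpoly set) \<subseteq> carrier (scroll_ring q)"
    using radical_generators_subset_scroll_ideal[OF q0] ideal_mpoly_ringD(1)[OF ideal_scroll_ideal]
    by (fastforce simp: scroll_ring_def)
  have "scroll_ideal q \<subseteq> radical (scroll_ring q) ?J"
  proof
    fix f :: "'k mpoly" assume f: "f \<in> scroll_ideal q"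
    show "f \<in> radical (scroll_ring q) ?J"
    \<comment> \<open>The radical is tested on the primes containing the generators.\<close>
    proof (rule in_radical_if_in_primes)
      show "ideal ?J (scroll_ring q)" by (rule genideal_ideal[OF gens_carrier])
      show "f \<in> carrier (scroll_ring q)"
        using f ideal_mpoly_ringD(1)[OF ideal_scroll_ideal] by (fastforce simp: scroll_ring_def)
      fix Q assume Q: "primeideal Q (scroll_ring q)" "?J \<subseteq> Q"
      then have "radical_generators q \<subseteq> Q" using genideal_self[OF gens_carrier] by blast
      with Q f show "f \<in> Q"
        using scroll_ideal_subset_prime[of q h Q] assms q by (auto simp: scroll_ring_def)
    qed
  qed
  moreover have "radical (scroll_ring q) ?J \<subseteq> scroll_ideal q"
  proof -
    have "?J \<subseteq> scroll_ideal q"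
      by (intro genideal_minimal I_ideal radical_generators_subset_scroll_ideal q0)
    from radical_mono[OF this] show ?thesis
      using primeideal.radical_eq[OF I] by blast
  qed
  ultimately have radical: "scroll_ideal q = radical (scroll_ring q) ?J" by blast
  moreover have "set_theoretic_complete_intersection (scroll_ring q) (scroll_ideal q :: 'k mpoly set)"
    unfolding set_theoretic_complete_intersection_def
  proof (intro conjI exI)
    \<comment> \<open>The length is \<open>(q - 1) + (q - 1) + 1 = 2 * q - 1\<close>, which is the
      height.\<close>
    define Ps :: "'k mpoly list" where
      "Ps = map F_poly [1..<q] @ map (G_poly q) [1..<q] @ [xvar 0 * yvar q q - xvar q * yvar q 0]"
    have "{1..<q} = {1..q - 1}" using q by auto
    then have set: "set Ps = radical_generators q"
      by (auto simp: Ps_def radical_generators_def)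
    show "enat (length Ps) = height (scroll_ring q) (scroll_ideal q :: 'k mpoly set)"
      unfolding height_scroll_ideal[OF q0] using q by (simp add: Ps_def)
    show "generates_up_to_radical (scroll_ring q) Ps (scroll_ideal q)"
      unfolding generates_up_to_radical_def set
      using gens_carrier radical primeideal.radical_eq[OF I] by simp
  qed (rule I_ideal)
  ultimately show ?thesis by (simp add: radical_generators_def)
qed

end
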